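(* Let $M = M^0(S; F(I), G(\Lambda); P)$ be a Rees matrix semigroup with zero over a semigroupoid $S$. Suppose $S$ is automatic and $M$ is finitely generated. Then $M$ is automatic.
   Context: Semigroupoids. A (directed) graph $X$ has a set $X^0$ of vertices, a set $X^1$ of edges, and source and target maps $\alpha,\omega: X^1\to X^0$. A semigroupoid $S$ is a small graph (vertices are called objects, edges are called arrows) with a partial multiplication on arrows such that $ef$ is defined if and only if $\omega(e)=\alpha(f)$, in which case $\alpha(ef)=\alpha(e)$ and $\omega(ef)=\omega(f)$, and $e(fg)=(ef)g$ whenever $ef$ and $fg$ are defined. (Thus a semigroupoid is a small category without the requirement of identities.) We write $s\in S$ for $s\in S^1$. $S$ is isolation-free if every object is the source or target of some arrow. A semigroup is regarded as a semigroupoid with one object. Paths and regularity. For a graph $X$, $X^+$ is the free semigroupoid on $X$: its objects are $X^0$, its arrows are the non-empty paths $e_1\cdots e_n$ with $\omega(e_i)=\alpha(e_{i+1})$. All graphs over which regularity is considered are finite. A language $L\subseteq X^+$ is regular if it is regular in the usual sense as a set of words over the alphabet $X^1$ (equivalently, it is accepted by a finite automaton labelled by the graph $X$). Let $X^{\$}$ be $X$ with one extra loop $\$_s$ at each vertex $s$. For $(a,b)\in X^+\times X^+$, let $\delta_X(a,b)\in (X^{\$}\times X^{\$})^+$ be the path obtained by padding the shorter of $a,b$ on the right with copies of $\$_t$, where $t$ is the target of that shorter path, to the length of the longer one, and reading the two paths as a single path of pairs of edges. A relation $R\subseteq X^+\times X^+$ is synchronously regular if $\delta_X(R)$ is a regular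 language (over the edges of $X^{\$}\times X^{\$}$). Automaticity. A choice of representatives for a semigroupoid $S$ is a triple $(X,K,\rho)$ where $X$ is a graph with $X^0=S^0$, $\rho:X^+\to S$ is a surjective semigroupoid morphism that is the identity on objects, and $K\subseteq X^+$ satisfies $\rho(K)=S^1$. It is finitely generated if $X$ has finitely many edges. An automatic structure for $S$ is a finitely generated choice of representatives $(X,K,\rho)$ such that the relation $K_a=\{(u,v)\in K\times K : \omega(u)=\alpha(a),\ \rho(ua)=\rho(v)\}$ is synchronously regular for each edge $a\in X^1$, and the relation $K_a=\{(u,v)\in K\times K: \omega(u)=a,\ \rho(u)=\rho(v)\}$ is synchronously regular for each vertex $a\in X^0$ (regarded as an empty path). $S$ is automatic if it admits an automatic structure. Rees matrix semigroups. Let $S$ be a non-empty isolation-free semigroupoid, $I,\Lambda$ index sets, $F:I\to\alpha(S^1)$ and $G:\Lambda\to\omega(S^1)$ surjective functions, $0$ a new symbol not in $S$, and $P$ a $\Lambda\times I$ matrix with entries in $S\cup\{0\}$ such that $\alpha(P_{\lambda i})=G(\lambda)$ and $\omega(P_{\lambda i})=F(i)$ whenever $P_{\lambda i}\neq 0$. The Rees matrix semigroup with zero $M^0(S;F(I),G(\Lambda);P)$ (the notation $F(I),G(\Lambda)$ is purely symbolic) has elements $\{0\}\cup\{(i,x,\lambda)\in I\times S\times\Lambda : F(i)=\alpha(x),\ \omega(x)=G(\lambda)\}$, with $(i,x,\lambda)(j,y,\mu)=(i,xP_{\lambda j}y,\mu)$ if $P_{\lambda j}\ne 0$ and $=0$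 otherwise, and $0m=m0=0$ for all $m$. *)

theory Defs
  imports "Graph_Theory.Arc_Walk"
begin

text \<open>Graphs are the multidigraphs of \<open>Graph_Theory\<close>: the source map is \<^const>\<open>tail\<close>, the target
  map is \<^const>\<open>head\<close>, the edges (arrows) are \<^const>\<open>arcs\<close>.\<close>

subsection \<open>Semigroupoids\<close>

text \<open>The partial product is a total function whose values on non-composable pairs of arrows
  are irrelevant.\<close>

record ('o, 'a) semigroupoid = "('o, 'a) pre_digraph" +
  mult :: "'a \<Rightarrow> 'a \<Rightarrow> 'a"

locale semigroupoid =
  fixes S :: "('o, 'a) semigroupoid"
  assumes wf_digraph: "wf_digraph (pre_digraph.truncate S)"
    and mult_closed: "\<lbrakk>e \<in> arcs S; f \<in> arcs S; head S e = tail S f\<rbrakk> \<Longrightarrow> mult S e f \<in> arcs S"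
    and tail_mult: "\<lbrakk>e \<in> arcs S; f \<in> arcs S; head S e = tail S f\<rbrakk> \<Longrightarrow> tail S (mult S e f) = tail S e"
    and head_mult: "\<lbrakk>e \<in> arcs S; f \<in> arcs S; head S e = tail S f\<rbrakk> \<Longrightarrow> head S (mult S e f) = head S f"
    and mult_assoc: "\<lbrakk>e \<in> arcs S; f \<in> arcs S; g \<in> arcs S; head S e = tail S f; head S f = tail S g\<rbrakk>
      \<Longrightarrow> mult S e (mult S f g) = mult S (mult S e f) g"

definition isolation_free :: "('o, 'a) semigroupoid \<Rightarrow> bool" where
  "isolation_free S \<longleftrightarrow> (\<forall>v\<in>verts S. \<exists>e\<in>arcs S. tail S e = v \<or> head S e = v)"

definition semigroupoid_hom ::
  "('o, 'a) semigroupoid \<Rightarrow> ('p, 'b) semigroupoid \<Rightarrow> ('o \<Rightarrow> 'p) \<Rightarrow> ('a \<Rightarrow> 'b) \<Rightarrow> bool" where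
  "semigroupoid_hom T S \<phi> \<rho> \<longleftrightarrow>
     \<phi> ` verts T \<subseteq> verts S \<and> \<rho> ` arcs T \<subseteq> arcs S \<and>
     (\<forall>e\<in>arcs T. tail S (\<rho> e) = \<phi> (tail T e) \<and> head S (\<rho> e) = \<phi> (head T e)) \<and>
     (\<forall>e\<in>arcs T. \<forall>f\<in>arcs T. head T e = tail T f \<longrightarrow> \<rho> (mult T e f) = mult S (\<rho> e) (\<rho> f))"

definition semigroup_as_semigroupoid ::
  "'a set \<Rightarrow> ('a \<Rightarrow> 'a \<Rightarrow> 'a) \<Rightarrow> (unit, 'a) semigroupoid" where
  "semigroup_as_semigroupoid C m =
     \<lparr>verts = {()}, arcs = C, tail = (\<lambda>_. ()), head = (\<lambda>_. ()), mult = m\<rparr>"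


subsection \<open>Paths and regularity\<close>

definition free_semigroupoid :: "('v, 'e) pre_digraph \<Rightarrow> ('v, 'e list) semigroupoid" where
  "free_semigroupoid X =
     \<lparr>verts = verts X,
      arcs = {p. p \<noteq> [] \<and> (\<exists>u v. pre_digraph.awalk X u p v)},
      tail = (\<lambda>p. tail X (hd p)),
      head = (\<lambda>p. head X (last p)),
      mult = (@)\<rparr>"

text \<open>Regular languages over a finite alphabet, by complete deterministic finite automata.
  Taking the states in \<^typ>\<open>nat\<close> is no restriction, as there are finitely many.\<close>

definition regular_language :: "'c set \<Rightarrow> 'c list set \<Rightarrow> bool" where
  "regular_language A L \<longleftrightarrow> finite A \<and>
     (\<exists>(Q :: nat set) \<delta> q0 Fin. finite Q \<and> q0 \<in> Q \<and> Fin \<subseteq> Q \<and> (\<forall>q\<in>Q. \<forall>c\<in>A. \<delta> q c \<in> Q) \<and>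
        L = {w \<in> lists A. foldl \<delta> q0 w \<in> Fin})"

datatype ('v, 'e) padded_edge = Edge 'e | Dollar 'v

definition padded_graph :: "('v, 'e) pre_digraph \<Rightarrow> ('v, ('v, 'e) padded_edge) pre_digraph" where
  "padded_graph X =
     \<lparr>verts = verts X,
      arcs = Edge ` arcs X \<union> Dollar ` verts X,
      tail = case_padded_edge (tail X) (\<lambda>v. v),
      head = case_padded_edge (head X) (\<lambda>v. v)\<rparr>"

definition graph_prod ::
  "('v, 'e) pre_digraph \<Rightarrow> ('w, 'f) pre_digraph \<Rightarrow> ('v \<times> 'w, 'e \<times> 'f) pre_digraph" where
  "graph_prod X Y =
     \<lparr>verts = verts X \<times> verts Y,
      arcs = arcs X \<times> arcs Y,
      tail = map_prod (tail X) (tail Y),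
      head = map_prod (head X) (head Y)\<rparr>"

text \<open>If \<open>n \<le> length p\<close>, no padding is added.\<close>

definition pad_to :: "('v, 'e) pre_digraph \<Rightarrow> nat \<Rightarrow> 'e list \<Rightarrow> ('v, 'e) padded_edge list" where
  "pad_to X n p = map Edge p @ replicate (n - length p) (Dollar (head X (last p)))"

definition pad_pair ::
  "('v, 'e) pre_digraph \<Rightarrow> 'e list \<times> 'e list \<Rightarrow> (('v, 'e) padded_edge \<times> ('v, 'e) padded_edge) list" where
  "pad_pair X = (\<lambda>(a, b). let n = max (length a) (length b) in zip (pad_to X n a) (pad_to X n b))"

definition synchronously_regular :: "('v, 'e) pre_digraph \<Rightarrow> ('e list \<times> 'e list) set \<Rightarrow> bool" where
  "synchronously_regular X R \<longleftrightarrow>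
     R \<subseteq> arcs (free_semigroupoid X) \<times> arcs (free_semigroupoid X) \<and>
     regular_language (arcs (graph_prod (padded_graph X) (padded_graph X))) (pad_pair X ` R)"


subsection \<open>Automaticity\<close>

locale choice_of_representatives = semigroupoid S + wf_digraph X
  for S :: "('o, 'a) semigroupoid" and X :: "('o, 'e) pre_digraph" +
  fixes K :: "'e list set" and \<rho> :: "'e list \<Rightarrow> 'a"
  assumes verts_eq: "verts X = verts S"
    and hom: "semigroupoid_hom (free_semigroupoid X) S (\<lambda>v. v) \<rho>"
    and surj: "\<rho> ` arcs (free_semigroupoid X) = arcs S"
    and K_subset: "K \<subseteq> arcs (free_semigroupoid X)"
    and image_K: "\<rho> ` K = arcs S"

text \<open>In the next two definitions, having the edges of \<open>X\<close> in \<^typ>\<open>nat\<close> is no restriction, as there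
  are finitely many.\<close>

definition finitely_generated :: "('o, 'a) semigroupoid \<Rightarrow> bool" where
  "finitely_generated S \<longleftrightarrow>
     (\<exists>(X :: ('o, nat) pre_digraph) K \<rho>. choice_of_representatives S X K \<rho> \<and> finite (arcs X))"

definition edge_relation ::
  "('o, 'e) pre_digraph \<Rightarrow> 'e list set \<Rightarrow> ('e list \<Rightarrow> 'a) \<Rightarrow> 'e \<Rightarrow> ('e list \<times> 'e list) set" where
  "edge_relation X K \<rho> a =
     {(u, v) \<in> K \<times> K. head (free_semigroupoid X) u = tail X a \<and> \<rho> (u @ [a]) = \<rho> v}"

definition vertex_relation ::
  "('o, 'e) pre_digraph \<Rightarrow> 'e list set \<Rightarrow> ('e list \<Rightarrow> 'a) \<Rightarrow> 'o \<Rightarrow> ('e list \<times> 'e list) set" where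
  "vertex_relation X K \<rho> s =
     {(u, v) \<in> K \<times> K. head (free_semigroupoid X) u = s \<and> \<rho> u = \<rho> v}"

text \<open>Besides finiteness of the edge set, \<^const>\<open>fin_digraph\<close> records the convention that
  regularity is only considered over finite graphs. Finiteness of the vertex set follows from that
  of the edge set when \<open>S\<close> is isolation-free or has one object.\<close>

definition automatic_structure ::
  "('o, 'a) semigroupoid \<Rightarrow> ('o, 'e) pre_digraph \<Rightarrow> 'e list set \<Rightarrow> ('e list \<Rightarrow> 'a) \<Rightarrow> bool" where
  "automatic_structure S X K \<rho> \<longleftrightarrow>
     choice_of_representatives S X K \<rho> \<and> fin_digraph X \<and>
     (\<forall>a\<in>arcs X. synchronously_regular X (edge_relation X K \<rho> a)) \<and>
     (\<forall>s\<in>verts X. synchronously_regular X (vertex_relation X K \<rho> s))"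

definition automatic :: "('o, 'a) semigroupoid \<Rightarrow> bool" where
  "automatic S \<longleftrightarrow> (\<exists>(X :: ('o, nat) pre_digraph) K \<rho>. automatic_structure S X K \<rho>)"


subsection \<open>Rees matrix semigroups with zero\<close>

text \<open>The adjoined zero is \<^const>\<open>None\<close>, both among the matrix entries and in the semigroup.\<close>

locale rees_data = semigroupoid S
  for S :: "('o, 'a) semigroupoid" +
  fixes I :: "'i set" and \<Lambda> :: "'l set"
    and F :: "'i \<Rightarrow> 'o" and G :: "'l \<Rightarrow> 'o"
    and P :: "'l \<Rightarrow> 'i \<Rightarrow> 'a option"
  assumes nonempty: "verts S \<noteq> {}"
    and isolation_free: "isolation_free S"
    and F_surj: "F ` I = tail S ` arcs S"
    and G_surj: "G ` \<Lambda> = head S ` arcs S"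
    and P_entry: "\<lbrakk>l \<in> \<Lambda>; i \<in> I; P l i = Some p\<rbrakk> \<Longrightarrow> p \<in> arcs S \<and> tail S p = G l \<and> head S p = F i"

definition rees_carrier ::
  "('o, 'a) semigroupoid \<Rightarrow> 'i set \<Rightarrow> 'l set \<Rightarrow> ('i \<Rightarrow> 'o) \<Rightarrow> ('l \<Rightarrow> 'o) \<Rightarrow> ('i \<times> 'a \<times> 'l) option set" where
  "rees_carrier S I \<Lambda> F G =
     {None} \<union>
     {Some (i, x, l) | i x l. i \<in> I \<and> x \<in> arcs S \<and> l \<in> \<Lambda> \<and> F i = tail S x \<and> head S x = G l}"

fun rees_mult ::
  "('o, 'a) semigroupoid \<Rightarrow> ('l \<Rightarrow> 'i \<Rightarrow> 'a option) \<Rightarrow>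
     ('i \<times> 'a \<times> 'l) option \<Rightarrow> ('i \<times> 'a \<times> 'l) option \<Rightarrow> ('i \<times> 'a \<times> 'l) option" where
  "rees_mult S P (Some (i, x, l)) (Some (j, y, m)) =
     (case P l j of None \<Rightarrow> None | Some p \<Rightarrow> Some (i, mult S (mult S x p) y, m))"
| "rees_mult S P _ _ = None"

definition rees_semigroup ::
  "('o, 'a) semigroupoid \<Rightarrow> 'i set \<Rightarrow> 'l set \<Rightarrow> ('i \<Rightarrow> 'o) \<Rightarrow> ('l \<Rightarrow> 'o) \<Rightarrow> ('l \<Rightarrow> 'i \<Rightarrow> 'a option) \<Rightarrow>
     (unit, ('i \<times> 'a \<times> 'l) option) semigroupoid" where
  "rees_semigroup S I \<Lambda> F G P = semigroup_as_semigroupoid (rees_carrier S I \<Lambda> F G) (rees_mult S P)"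

end

theory Submission
  imports Defs
begin

text \<open>Let \<open>V\<close> be the set of all products \<open>x p y\<close> in \<open>S\<close> with \<open>p\<close> a nonzero matrix entry. If \<open>M\<close> is finitely
  generated, then \<open>I\<close>, \<open>\<Lambda>\<close> and \<open>S - V\<close> are finite, because an element \<open>(i, x, \<lambda>)\<close> with \<open>x\<close> outside \<open>V\<close> must
  be a generator. By pumping, every element of \<open>S\<close> is represented by a word \<open>B\<^sub>1 \<dots> B\<^sub>m R\<close> of \<open>K\<close> whose
  blocks \<open>B\<^sub>j\<close> of a fixed length \<open>N\<close> have values \<open>b\<^sub>j p\<^sub>j c\<^sub>j\<close> in \<open>V\<close>, where \<open>p\<^sub>j\<close> is the entry at \<open>(\<lambda>\<^sub>j, i\<^sub>j)\<close>. Then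
  \<open>(i, b\<^sub>1, \<lambda>\<^sub>1)(i\<^sub>1, c\<^sub>1 b\<^sub>2, \<lambda>\<^sub>2) \<dots> (i\<^sub>m, c\<^sub>m R, \<lambda>)\<close> is a word over a finite set of elements of \<open>M\<close> that
  represents \<open>(i, B\<^sub>1 \<dots> B\<^sub>m R, \<lambda>)\<close>. One letter corresponds to exactly \<open>N\<close> edges, apart from the last one, so
  this encoding preserves synchronous regularity. Right multiplication by \<open>(j, s, \<mu>)\<close> becomes right
  multiplication by \<open>p s\<close> in \<open>S\<close>, a composite of finitely many relations \<open>K\<^sub>a\<close>.

  Regularity is handled through the Myhill-Nerode criterion: all closure properties reduce to counting
  residuals.\<close>

subsection \<open>Recognizable languages\<close>

text \<open>The left quotient: the state that the minimal automaton of \<open>L\<close> reaches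
  after reading \<open>w\<close>.\<close>

definition residual :: "'c list set \<Rightarrow> 'c list \<Rightarrow> 'c list set" where
  "residual L w = {z. w @ z \<in> L}"

text \<open>The Myhill-Nerode condition. It does not mention an alphabet, so preimages and
  projections need no side conditions on letters.\<close>

definition recognizable :: "'c list set \<Rightarrow> bool" where
  "recognizable L \<longleftrightarrow> finite (range (residual L))"

lemma residual_Nil [simp]: "residual L [] = L"
  by (simp add: residual_def)

lemma residual_append: "residual L (u @ v) = residual (residual L u) v"
  by (simp add: residual_def)

lemma recognizableI:
  assumes "finite \<F>" "\<And>w. residual L w \<in> \<F>"
  shows "recognizable L"
  unfolding recognizable_def using assms by (auto intro: finite_subset)

text \<open>The family plays the states of a deterministic automaton: closure under reading one
  letter captures every residual, by induction on the word.\<close>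

lemma recognizable_family:
  assumes "finite \<F>" "L \<in> \<F>" and step: "\<And>M y. M \<in> \<F> \<Longrightarrow> residual M [y] \<in> \<F>"
  shows "recognizable L"
proof (rule recognizableI[OF \<open>finite \<F>\<close>])
  fix w show "residual L w \<in> \<F>"
  proof (induction w rule: rev_induct)
    case (snoc y w)
    then show ?case by (simp add: residual_append step)
  qed (simp add: \<open>L \<in> \<F>\<close>)
qed

lemma recognizable_Int:
  assumes "recognizable L" "recognizable M"
  shows "recognizable (L \<inter> M)"
proof (rule recognizableI)
  show "finite ((\<lambda>(A, B). A \<inter> B) ` (range (residual L) \<times> range (residual M)))"
    using assms by (auto simp: recognizable_def)
  fix w
  have "residual (L \<inter> M) w = residual L w \<inter> residual M w"
    by (auto simp: residual_def)
  then show "residual (L \<inter> M) w \<in> (\<lambda>(A, B). A \<inter> B) ` (range (residual L) \<times> range (residual M))"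
    by blast
qed

lemma recognizable_Un:
  assumes "recognizable L" "recognizable M"
  shows "recognizable (L \<union> M)"
proof (rule recognizableI)
  show "finite ((\<lambda>(A, B). A \<union> B) ` (range (residual L) \<times> range (residual M)))"
    using assms by (auto simp: recognizable_def)
  fix w
  have "residual (L \<union> M) w = residual L w \<union> residual M w"
    by (auto simp: residual_def)
  then show "residual (L \<union> M) w \<in> (\<lambda>(A, B). A \<union> B) ` (range (residual L) \<times> range (residual M))"
    by blast
qed

lemma recognizable_empty: "recognizable {}"
  by (rule recognizableI[of "{{}}"]) (auto simp: residual_def)

lemma recognizable_UN:
  assumes "finite J" "\<And>i. i \<in> J \<Longrightarrow> recognizable (L i)"
  shows "recognizable (\<Union>i\<in>J. L i)"
  using assms by (induction J) (auto intro: recognizable_Un recognizable_empty)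

text \<open>Residuals of the preimage under the morphism extending \<open>f\<close> are preimages of
  residuals. Since \<open>f\<close> may return long words, this allows a letter to be read as a
  whole block of edges.\<close>

lemma recognizable_concat_vimage:
  assumes "recognizable L"
  shows "recognizable {w. concat (map f w) \<in> L}"
proof (rule recognizableI)
  show "finite ((\<lambda>M. {w. concat (map f w) \<in> M}) ` range (residual L))"
    using assms by (auto simp: recognizable_def)
  fix w
  have "residual {w. concat (map f w) \<in> L} w = {z. concat (map f z) \<in> residual L (concat (map f w))}"
    by (auto simp: residual_def)
  then show "residual {w. concat (map f w) \<in> L} w
      \<in> (\<lambda>M. {w. concat (map f w) \<in> M}) ` range (residual L)"
    by blast
qed

lemma recognizable_map_vimage:
  assumes "recognizable L"
  shows "recognizable {w. map f w \<in> L}"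
proof -
  have "map f w = concat (map (\<lambda>x. [f x]) w)" for w
    by (induction w) auto
  then show ?thesis
    using recognizable_concat_vimage[OF assms, of "\<lambda>x. [f x]"] by simp
qed

text \<open>Subset construction: a residual of the image depends only on the set of residuals of
  \<open>L\<close> at the preimages of \<open>w\<close>, and there are finitely many such
  sets.\<close>

lemma recognizable_map_image:
  assumes "recognizable L"
  shows "recognizable (map f ` L)"
proof (rule recognizableI)
  show "finite ((\<lambda>\<A>. \<Union>M\<in>\<A>. map f ` M) ` Pow (range (residual L)))"
    using assms by (auto simp: recognizable_def)
  fix w
  have "residual (map f ` L) w = (\<Union>M\<in>residual L ` {w'. map f w' = w}. map f ` M)"
  proof (intro equalityI subsetI)
    fix z assume "z \<in> residual (map f ` L) w"
    then obtain x where "x \<in> L" "map f x = w @ z"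
      by (auto simp: residual_def)
    then obtain w' z' where "x = w' @ z'" "map f w' = w" "map f z' = z"
      by (auto simp: map_eq_append_conv)
    with \<open>x \<in> L\<close> show "z \<in> (\<Union>M\<in>residual L ` {w'. map f w' = w}. map f ` M)"
      by (auto simp: residual_def)
  next
    fix z assume "z \<in> (\<Union>M\<in>residual L ` {w'. map f w' = w}. map f ` M)"
    then obtain w' z' where "map f w' = w" "z = map f z'" "w' @ z' \<in> L"
      by (auto simp: residual_def)
    then have "w @ z = map f (w' @ z')"
      by simp
    with \<open>w' @ z' \<in> L\<close> show "z \<in> residual (map f ` L) w"
      unfolding residual_def by blast
  qed
  moreover have "residual L ` {w'. map f w' = w} \<in> Pow (range (residual L))"
    by blast
  ultimately show "residual (map f ` L) w
      \<in> (\<lambda>\<A>. \<Union>M\<in>\<A>. map f ` M) ` Pow (range (residual L))"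
    by (rule image_eqI)
qed

text \<open>Stripping acts at the right end of a word and taking residuals at the left end, so the
  two commute.\<close>

lemma recognizable_strip:
  assumes "recognizable L"
  shows "recognizable {w. \<exists>k. w @ replicate k c \<in> L}"
proof (rule recognizableI)
  show "finite ((\<lambda>M. {z. \<exists>k. z @ replicate k c \<in> M}) ` range (residual L))"
    using assms by (auto simp: recognizable_def)
  fix w
  have "residual {w. \<exists>k. w @ replicate k c \<in> L} w = {z. \<exists>k. z @ replicate k c \<in> residual L w}"
    by (auto simp: residual_def)
  then show "residual {w. \<exists>k. w @ replicate k c \<in> L} w
      \<in> (\<lambda>M. {z. \<exists>k. z @ replicate k c \<in> M}) ` range (residual L)"
    by blast
qed

definition saturate :: "'c \<Rightarrow> 'c list set \<Rightarrow> 'c list set" where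
  "saturate c L = {x @ replicate k c | x k. x \<in> L}"

lemma append_eq_replicateD:
  assumes "us @ vs = replicate k c"
  shows "us = replicate (length us) c" "vs = replicate (length vs) c"
proof -
  have "set us \<subseteq> {c}" "set vs \<subseteq> {c}"
    using arg_cong[OF assms, of set] by (auto split: if_splits)
  then show "us = replicate (length us) c" "vs = replicate (length vs) c"
    by (metis replicate_length_same singletonD subsetD)+
qed

text \<open>The residual at \<open>w\<close> is determined by the residual of \<open>L\<close> at
  \<open>w\<close> and one bit: whether \<open>w\<close> is already a word of \<open>L\<close>
  followed by padding, in which case any further padding is accepted too.\<close>

lemma recognizable_saturate:
  assumes "recognizable L"
  shows "recognizable (saturate c L)"
proof (rule recognizableI)
  let ?g = "\<lambda>(M, t). saturate c M \<union> (if t then range (\<lambda>k. replicate k c) else {})"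
  show "finite (?g ` (range (residual L) \<times> UNIV))"
    using assms by (auto simp: recognizable_def)
  fix w
  have "residual (saturate c L) w = ?g (residual L w, \<exists>x j. w = x @ replicate j c \<and> x \<in> L)"
    (is "_ = ?r")
  proof (intro equalityI subsetI)
    fix z assume "z \<in> residual (saturate c L) w"
    then obtain x k where "w @ z = x @ replicate k c" "x \<in> L"
      by (auto simp: residual_def saturate_def)
    then consider us where "x = w @ us" "us @ replicate k c = z"
      | us where "w = x @ us" "us @ z = replicate k c"
      by (auto simp: append_eq_append_conv2)
    then show "z \<in> ?r"
    proof cases
      case 1
      with \<open>x \<in> L\<close> show ?thesis
        by (auto simp: residual_def saturate_def)
    next
      case 2
      then have "us = replicate (length us) c" "z = replicate (length z) c"
        by (auto dest: append_eq_replicateD)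
      with 2 \<open>x \<in> L\<close> have "\<exists>x j. w = x @ replicate j c \<and> x \<in> L"
        by blast
      moreover have "z \<in> range (\<lambda>k. replicate k c)"
        using \<open>z = replicate (length z) c\<close> by blast
      ultimately show ?thesis
        by simp
    qed
  next
    fix z assume "z \<in> ?r"
    then show "z \<in> residual (saturate c L) w"
    proof (cases "z \<in> saturate c (residual L w)")
      case True
      then show ?thesis
        unfolding residual_def saturate_def mem_Collect_eq by (metis append.assoc)
    next
      case False
      with \<open>z \<in> ?r\<close> obtain x j k where "w = x @ replicate j c" "x \<in> L" "z = replicate k c"
        by (auto split: if_splits)
      then have "w @ z = x @ replicate (j + k) c"
        by (simp add: replicate_add)
      with \<open>x \<in> L\<close> show ?thesis
        unfolding residual_def saturate_def by blast
    qed
  qed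
  then show "residual (saturate c L) w \<in> ?g ` (range (residual L) \<times> UNIV)"
    by blast
qed

lemma recognizable_lists: "recognizable (lists B)"
  by (rule recognizable_family[of "{lists B, {}}"]) (auto simp: residual_def)

lemma recognizable_hd: "recognizable {w. w \<noteq> [] \<and> Q (hd w)}"
  by (rule recognizable_family[of "{{w. w \<noteq> [] \<and> Q (hd w)}, UNIV, {}}"]) (auto simp: residual_def)

lemma recognizable_singleton: "recognizable {[y]}"
  by (rule recognizable_family[of "{{[y]}, {[]}, {}}"]) (auto simp: residual_def)

text \<open>Each residual is the language accepted from some state, or is empty once a letter
  outside \<open>A\<close> has been read.\<close>

lemma recognizable_if_regular_language:
  assumes "regular_language A L"
  shows "recognizable L"
proof -
  obtain Q :: "nat set" and \<delta> q0 Fin where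
    Q: "finite Q" "q0 \<in> Q" "\<And>q c. q \<in> Q \<Longrightarrow> c \<in> A \<Longrightarrow> \<delta> q c \<in> Q"
    and L: "L = {w \<in> lists A. foldl \<delta> q0 w \<in> Fin}"
    using assms unfolding regular_language_def by metis
  let ?g = "\<lambda>q. {z \<in> lists A. foldl \<delta> q z \<in> Fin}"
  show ?thesis
  proof (rule recognizable_family)
    show "finite (insert {} (?g ` Q))" "L \<in> insert {} (?g ` Q)"
      using Q L by auto
    fix M y assume "M \<in> insert {} (?g ` Q)"
    then consider "M = {}" | q where "q \<in> Q" "M = ?g q" by blast
    then show "residual M [y] \<in> insert {} (?g ` Q)"
    proof cases
      case 2
      then have "residual M [y] = (if y \<in> A then ?g (\<delta> q y) else {})"
        by (auto simp: residual_def)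
      with 2 Q(3) show ?thesis by auto
    qed (simp add: residual_def)
  qed
qed

text \<open>The Myhill-Nerode automaton: residuals are the states, numbered by an injection
  \<open>f\<close> because states have type \<open>nat\<close>, and \<open>g\<close> inverts the
  numbering. A state accepts when its residual contains \<open>[]\<close>.\<close>

lemma regular_language_if_recognizable:
  assumes "finite A" "L \<subseteq> lists A" "recognizable L"
  shows "regular_language A L"
proof -
  have fin: "finite (range (residual L))"
    using assms(3) by (simp add: recognizable_def)
  then obtain f :: "'a list set \<Rightarrow> nat" where f: "inj_on f (range (residual L))"
    using finite_imp_inj_to_nat_seg[OF fin] by blast
  define g where "g = the_inv_into (range (residual L)) f"
  have g: "g (f (residual L w)) = residual L w" for w
    by (simp add: g_def the_inv_into_f_f[OF f])
  define \<delta> where "\<delta> q c = f (residual (g q) [c])" for q c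
  have run: "foldl \<delta> (f L) w = f (residual L w)" for w
  proof (induction w rule: rev_induct)
    case (snoc c w)
    then show ?case by (simp add: \<delta>_def g residual_append)
  qed simp
  have closed: "\<delta> q c \<in> f ` range (residual L)" if "q \<in> f ` range (residual L)" for q c
  proof -
    from that obtain w where "q = f (residual L w)" by blast
    then have "\<delta> q c = f (residual L (w @ [c]))" by (simp add: \<delta>_def g residual_append)
    then show ?thesis by blast
  qed
  have mem: "f (residual L w) \<in> f ` {M \<in> range (residual L). [] \<in> M} \<longleftrightarrow> w \<in> L" for w
  proof -
    have "f (residual L w) \<in> f ` {M \<in> range (residual L). [] \<in> M}
        \<longleftrightarrow> residual L w \<in> {M \<in> range (residual L). [] \<in> M}"
      by (rule inj_on_image_mem_iff[OF f]) auto
    then show ?thesis by (simp add: residual_def)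
  qed
  have "f L \<in> f ` range (residual L)"
    by (metis residual_Nil rangeI imageI)
  moreover have "L = {w \<in> lists A. foldl \<delta> (f L) w \<in> f ` {M \<in> range (residual L). [] \<in> M}}"
    using assms(2) by (auto simp only: run mem)
  moreover have "f ` {M \<in> range (residual L). [] \<in> M} \<subseteq> f ` range (residual L)"
    by blast
  moreover have "\<forall>q\<in>f ` range (residual L). \<forall>c\<in>A. \<delta> q c \<in> f ` range (residual L)"
    using closed by blast
  ultimately show ?thesis
    unfolding regular_language_def using assms(1) finite_imageI[OF fin, of f] by meson
qed

subsection \<open>Convolutions of relations\<close>

text \<open>A counterpart of \<open>pad_to\<close> whose blank \<open>None\<close> does not remember
  an end vertex, so that it serves words over any type.\<close>

definition padded :: "nat \<Rightarrow> 'c list \<Rightarrow> 'c option list" where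
  "padded n u = map Some u @ replicate (n - length u) None"

definition padded_zip :: "nat \<Rightarrow> 'c list \<times> 'd list \<Rightarrow> ('c option \<times> 'd option) list" where
  "padded_zip n r = zip (padded n (fst r)) (padded n (snd r))"

definition convolution :: "('c list \<times> 'd list) set \<Rightarrow> ('c option \<times> 'd option) list set" where
  "convolution R = (\<lambda>r. padded_zip (max (length (fst r)) (length (snd r))) r) ` R"

text \<open>Every common length that fits both words is allowed. This lets the words of different
  relations be padded to the same length, as composition and block decoding require.\<close>

definition saturated_convolution ::
  "('c list \<times> 'd list) set \<Rightarrow> ('c option \<times> 'd option) list set" where
  "saturated_convolution R =
     {padded_zip n (u, v) | n u v. (u, v) \<in> R \<and> length u \<le> n \<and> length v \<le> n}"

lemma length_padded [simp]: "length u \<le> n \<Longrightarrow> length (padded n u) = n"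
  by (simp add: padded_def)

lemma padded_add: "length u \<le> n \<Longrightarrow> padded (n + k) u = padded n u @ replicate k None"
  by (simp add: padded_def replicate_add[symmetric])

text \<open>Deleting the blanks recovers the word, whatever the padding length; hence
  \<open>n\<close> and \<open>m\<close> may differ.\<close>

lemma padded_inj:
  assumes "padded n u = padded m v"
  shows "u = v"
proof -
  have "concat (map (\<lambda>x. case x of None \<Rightarrow> [] | Some y \<Rightarrow> [y]) (padded n u)) = u" for n and u :: "'a list"
    by (induction u) (auto simp: padded_def map_replicate_const concat_replicate_trivial comp_def)
  then show ?thesis using assms by metis
qed

lemma saturated_convolution_eq:
  "saturated_convolution R = saturate (None, None) (convolution R)"
proof (intro equalityI subsetI)
  fix W assume "W \<in> saturated_convolution R"
  then obtain n u v where *: "W = padded_zip n (u, v)" "(u, v) \<in> R" "length u \<le> n" "length v \<le> n"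
    by (auto simp: saturated_convolution_def)
  define m where "m = max (length u) (length v)"
  obtain k where k: "n = m + k"
    using *(3,4) le_Suc_ex[of m n] by (auto simp: m_def)
  have "W = padded_zip m (u, v) @ replicate k (None, None)"
    unfolding *(1) k padded_zip_def by (simp add: padded_add m_def zip_append zip_replicate)
  then show "W \<in> saturate (None, None) (convolution R)"
    using *(2) unfolding saturate_def convolution_def m_def by force
next
  fix W assume "W \<in> saturate (None, None) (convolution R)"
  then obtain u v k where uv: "(u, v) \<in> R"
    and W: "W = padded_zip (max (length u) (length v)) (u, v) @ replicate k (None, None)"
    by (auto simp: saturate_def convolution_def)
  have "W = padded_zip (max (length u) (length v) + k) (u, v)"
    unfolding W by (simp add: padded_zip_def padded_add zip_append zip_replicate)
  with uv show "W \<in> saturated_convolution R"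
    unfolding saturated_convolution_def by force
qed

text \<open>With minimal padding, the longer word fills every position.\<close>

lemma None_notin_convolution: "W \<in> convolution R \<Longrightarrow> (None, None) \<notin> set W"
  by (auto simp: convolution_def padded_zip_def padded_def set_zip nth_append split: if_splits)

lemma convolution_eq:
  "convolution R = saturated_convolution R \<inter> lists (- {(None, None)})"
  unfolding saturated_convolution_eq
proof (intro equalityI subsetI)
  fix W assume W: "W \<in> convolution R"
  then have "W \<in> saturate (None, None) (convolution R)"
    unfolding saturate_def by (force intro: exI[of _ 0])
  with None_notin_convolution[OF W] show
    "W \<in> saturate (None, None) (convolution R) \<inter> lists (- {(None, None)})"
    by auto
qed (auto simp: saturate_def)

text \<open>Saturation only appends pairs of blanks, and forbidding that letter removes them again.
  Both passages preserve recognizability.\<close>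

lemma recognizable_saturated_convolution_iff:
  "recognizable (saturated_convolution R) \<longleftrightarrow> recognizable (convolution R)"
  using recognizable_saturate[of "convolution R" "(None, None)"]
    recognizable_Int[OF _ recognizable_lists, of "saturated_convolution R" "- {(None, None)}"]
  unfolding saturated_convolution_eq[symmetric] convolution_eq[symmetric] by blast

lemma convolution_Un: "convolution (R \<union> R') = convolution R \<union> convolution R'"
  by (simp add: convolution_def image_Un)

lemma convolution_UN: "convolution (\<Union>i\<in>J. R i) = (\<Union>i\<in>J. convolution (R i))"
  by (simp add: convolution_def image_UN)

lemma recognizable_saturated_convolution_Un:
  "\<lbrakk>recognizable (saturated_convolution R); recognizable (saturated_convolution R')\<rbrakk>
    \<Longrightarrow> recognizable (saturated_convolution (R \<union> R'))"
  by (simp add: recognizable_saturated_convolution_iff convolution_Un recognizable_Un)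

lemma recognizable_saturated_convolution_UN:
  "\<lbrakk>finite J; \<And>i. i \<in> J \<Longrightarrow> recognizable (saturated_convolution (R i))\<rbrakk>
    \<Longrightarrow> recognizable (saturated_convolution (\<Union>i\<in>J. R i))"
  by (simp add: recognizable_saturated_convolution_iff convolution_UN recognizable_UN)

section \<open>Direct products of languages as relations\<close>

definition padded_language :: "'c list set \<Rightarrow> 'c option list set" where
  "padded_language L = {padded n u | n u. u \<in> L \<and> length u \<le> n}"

lemma padded_language_eq: "padded_language L = saturate None (map Some ` L)"
proof (intro equalityI subsetI)
  fix W assume "W \<in> saturate None (map Some ` L)"
  then obtain u k where "u \<in> L" "W = map Some u @ replicate k None"
    by (auto simp: saturate_def)
  then have "W = padded (length u + k) u" by (simp add: padded_def)
  with \<open>u \<in> L\<close> show "W \<in> padded_language L"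
    unfolding padded_language_def by force
qed (auto simp: padded_language_def saturate_def padded_def)

lemma recognizable_padded_language: "recognizable L \<Longrightarrow> recognizable (padded_language L)"
  unfolding padded_language_eq by (intro recognizable_saturate recognizable_map_image)

lemma map_padded_zip:
  assumes "length u \<le> n" "length v \<le> n"
  shows "map fst (padded_zip n (u, v)) = padded n u" "map snd (padded_zip n (u, v)) = padded n v"
  using assms by (simp_all add: padded_zip_def)

text \<open>The two tracks of a word of pairs have the same length, so padded words recognized
  separately on each track automatically share \<open>n\<close>.\<close>

lemma saturated_convolution_Times:
  "saturated_convolution (L \<times> M) =
     {W. map fst W \<in> padded_language L} \<inter> {W. map snd W \<in> padded_language M}"
proof (intro equalityI subsetI)
  fix W assume "W \<in> saturated_convolution (L \<times> M)"
  then show "W \<in> {W. map fst W \<in> padded_language L} \<inter> {W. map snd W \<in> padded_language M}"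
    unfolding saturated_convolution_def padded_language_def Int_iff mem_Collect_eq mem_Times_iff
    by (metis map_padded_zip fst_conv snd_conv)
next
  fix W assume "W \<in> {W. map fst W \<in> padded_language L} \<inter> {W. map snd W \<in> padded_language M}"
  then obtain n m u v where W: "map fst W = padded n u" "map snd W = padded m v"
    and uv: "u \<in> L" "v \<in> M" "length u \<le> n" "length v \<le> m"
    unfolding padded_language_def by auto
  have "n = length W" "m = length W"
    using arg_cong[OF W(1), of length] arg_cong[OF W(2), of length] uv by simp_all
  then have "padded_zip n (u, v) = zip (map fst W) (map snd W)"
    unfolding W padded_zip_def by simp
  also have "\<dots> = W"
    by (rule zip_map_fst_snd)
  finally show "W \<in> saturated_convolution (L \<times> M)"
    using uv \<open>n = length W\<close> \<open>m = length W\<close> unfolding saturated_convolution_def by force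
qed

lemma recognizable_saturated_convolution_Times:
  assumes "recognizable L" "recognizable M"
  shows "recognizable (saturated_convolution (L \<times> M))"
  unfolding saturated_convolution_Times using assms
  by (intro recognizable_Int recognizable_map_vimage recognizable_padded_language)

text \<open>A run of the composite has to guess the middle word, which may be longer than both outer words;
  stripping trailing blanks from the projection accounts for that.\<close>

lemma recognizable_relcomp:
  assumes "recognizable (saturated_convolution R)" "recognizable (saturated_convolution R')"
  shows "recognizable (saturated_convolution (R O R'))"
proof -
  \<comment> \<open>Three tracks carry \<open>u\<close>, \<open>v\<close> and \<open>w\<close>: the
    two relations are tested on overlapping pairs of tracks, and \<open>E\<close> then projects the
    middle track away.\<close>
  define L3 where "L3 = {W. map (\<lambda>(x, y, z). (x, y)) W \<in> saturated_convolution R}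
    \<inter> {W. map (\<lambda>(x, y, z). (y, z)) W \<in> saturated_convolution R'}"
  define E where "E = {W. \<exists>k. W @ replicate k (None, None) \<in> map (\<lambda>(x, y, z). (x, z)) ` L3}"
  have "recognizable L3"
    unfolding L3_def
    by (rule recognizable_Int; rule recognizable_map_vimage; rule assms)
  then have "recognizable E"
    unfolding E_def by (rule recognizable_strip[OF recognizable_map_image])
  moreover have "E = saturated_convolution (R O R')"
  proof (intro equalityI subsetI)
    fix W assume "W \<in> E"
    then obtain k T where T: "W @ replicate k (None, None) = map (\<lambda>(x, y, z). (x, z)) T" "T \<in> L3"
      by (auto simp: E_def)
    obtain n u v where 1: "map (\<lambda>(x, y, z). (x, y)) T = padded_zip n (u, v)"
      "(u, v) \<in> R" "length u \<le> n" "length v \<le> n"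
      using T(2) unfolding L3_def saturated_convolution_def by blast
    obtain n' v' w where 2: "map (\<lambda>(x, y, z). (y, z)) T = padded_zip n' (v', w)"
      "(v', w) \<in> R'" "length v' \<le> n'" "length w \<le> n'"
      using T(2) unfolding L3_def saturated_convolution_def by blast
    have tracks: "map fst (map (\<lambda>(x, y, z). (x, y)) T) = map fst T"
      "map snd (map (\<lambda>(x, y, z). (x, y)) T) = map (fst \<circ> snd) T"
      "map fst (map (\<lambda>(x, y, z). (y, z)) T) = map (fst \<circ> snd) T"
      "map snd (map (\<lambda>(x, y, z). (y, z)) T) = map (snd \<circ> snd) T"
      by auto
    have x: "map fst T = padded n u" and y: "map (fst \<circ> snd) T = padded n v"
      using tracks(1,2) unfolding 1(1) map_padded_zip[OF 1(3,4)] by simp_all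
    have y': "map (fst \<circ> snd) T = padded n' v'" and z: "map (snd \<circ> snd) T = padded n' w"
      using tracks(3,4) unfolding 2(1) map_padded_zip[OF 2(3,4)] by simp_all
    have "v = v'" using y y' padded_inj by metis
    have "n = n'" using arg_cong[OF y, of length] arg_cong[OF y', of length] 1 2 by simp
    have "W @ replicate k (None, None) = zip (map fst T) (map (snd \<circ> snd) T)"
      unfolding T(1) by (induction T) auto
    then have "W @ replicate k (None, None) = padded_zip n (u, w)"
      unfolding x z padded_zip_def \<open>n = n'\<close> by simp
    then have "W @ replicate k (None, None) \<in> saturated_convolution (R O R')"
      using 1 2 \<open>v = v'\<close> \<open>n = n'\<close> unfolding saturated_convolution_def by blast
    \<comment> \<open>\<open>Z\<close> is minimally padded and contains no pair of blanks. As
      \<open>W\<close> differs from a padding of \<open>Z\<close> only in trailing pairs of blanks,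
      it cannot be a proper prefix of \<open>Z\<close>.\<close>
    then obtain Z j where Z: "Z \<in> convolution (R O R')"
      "W @ replicate k (None, None) = Z @ replicate j (None, None)"
      unfolding saturated_convolution_eq saturate_def by auto
    then consider us where "W = Z @ us" "us @ replicate k (None, None) = replicate j (None, None)"
      | us where "W @ us = Z" "replicate k (None, None) = us @ replicate j (None, None)"
      by (auto simp: append_eq_append_conv2)
    then have "\<exists>i. W = Z @ replicate i (None, None)"
    proof cases
      case 1
      then show ?thesis by (metis append_eq_replicateD)
    next
      case 2
      then have "us = replicate (length us) (None, None)"
        by (metis append_eq_replicateD)
      moreover have "(None, None) \<notin> set us"
        using None_notin_convolution[OF Z(1)] 2(1) by auto
      ultimately have "us = []"
        by (cases us) auto
      with 2 show ?thesis by (intro exI[of _ 0]) simp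
    qed
    with Z(1) show "W \<in> saturated_convolution (R O R')"
      unfolding saturated_convolution_eq saturate_def by auto
  next
    fix W assume "W \<in> saturated_convolution (R O R')"
    then obtain n u v w where W: "W = padded_zip n (u, w)" "(u, v) \<in> R" "(v, w) \<in> R'"
      "length u \<le> n" "length w \<le> n"
      unfolding saturated_convolution_def by blast
    \<comment> \<open>Long enough for the middle word as well; the \<open>length v\<close> extra
      columns are blank on both outer tracks and get stripped.\<close>
    define m where "m = n + length v"
    define T where "T = zip (padded m u) (zip (padded m v) (padded m w))"
    have len: "length u \<le> m" "length v \<le> m" "length w \<le> m"
      using W by (simp_all add: m_def)
    have "map (\<lambda>(x, y, z). (x, y)) (zip xs (zip ys zs)) = zip xs ys"
      "map (\<lambda>(x, y, z). (y, z)) (zip xs (zip ys zs)) = zip ys zs"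
      "map (\<lambda>(x, y, z). (x, z)) (zip xs (zip ys zs)) = zip xs zs"
      if "length xs = length ys" "length ys = length zs"
      for xs :: "'a option list" and ys :: "'b option list" and zs :: "'c option list"
      using that by (induction xs ys zs rule: list_induct3) auto
    then have T3: "map (\<lambda>(x, y, z). (x, y)) T = padded_zip m (u, v)"
      "map (\<lambda>(x, y, z). (y, z)) T = padded_zip m (v, w)"
      "map (\<lambda>(x, y, z). (x, z)) T = padded_zip m (u, w)"
      unfolding T_def padded_zip_def using len by simp_all
    have "T \<in> L3"
      using T3 W len unfolding L3_def saturated_convolution_def by auto
    moreover have "W @ replicate (length v) (None, None) = padded_zip m (u, w)"
      unfolding W(1) m_def using W(4,5) by (simp add: padded_zip_def padded_add zip_append zip_replicate)
    ultimately show "W \<in> E"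
      unfolding E_def mem_Collect_eq using T3(3) by (metis imageI)
  qed
  ultimately show ?thesis by simp
qed

section \<open>From synchronous regularity to recognizability\<close>

lemma map_map_prod_zip: "map (map_prod f g) (zip xs ys) = zip (map f xs) (map g ys)"
  unfolding zip_map_map map_prod_def ..

definition unpad_edge :: "('v, 'e) padded_edge \<Rightarrow> 'e option" where
  "unpad_edge = case_padded_edge Some (\<lambda>_. None)"

text \<open>Forgetting the vertex carried by each \<open>Dollar\<close> is a letter-to-letter map
  that turns \<open>pad_pair X\<close> into the convolution.\<close>

lemma recognizable_if_synchronously_regular:
  assumes "synchronously_regular X R"
  shows "recognizable (saturated_convolution R)"
proof -
  have "map (map_prod unpad_edge unpad_edge) (pad_pair X r)
      = padded_zip (max (length (fst r)) (length (snd r))) r" for r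
  proof -
    have "map unpad_edge (pad_to X n p) = padded n p" for n p
      by (simp add: pad_to_def padded_def unpad_edge_def comp_def)
    then show ?thesis
      by (cases r) (simp add: pad_pair_def padded_zip_def Let_def map_map_prod_zip)
  qed
  then have "convolution R = map (map_prod unpad_edge unpad_edge) ` pad_pair X ` R"
    by (auto simp: convolution_def image_image)
  moreover have "recognizable (pad_pair X ` R)"
    using assms recognizable_if_regular_language by (auto simp: synchronously_regular_def)
  ultimately show ?thesis
    by (simp add: recognizable_saturated_convolution_iff recognizable_map_image)
qed

subsection \<open>Paths\<close>

text \<open>Replaces the existential end points of \<open>awalk\<close> by a local condition on
  consecutive edges, so that factors of paths are accessible to list lemmas.\<close>

lemma paths_iff:
  assumes "wf_digraph X"
  shows "p \<in> arcs (free_semigroupoid X) \<longleftrightarrow>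
    p \<noteq> [] \<and> set p \<subseteq> arcs X \<and> successively (\<lambda>a b. head X a = tail X b) p"
proof -
  interpret wf_digraph X by fact
  have cas: "(\<exists>v. cas u p v) \<longleftrightarrow> (p \<noteq> [] \<longrightarrow> u = tail X (hd p)) \<and> successively (\<lambda>a b. head X a = tail X b) p"
    for u p
  proof (induction p arbitrary: u)
    case (Cons a p)
    have "(\<exists>v. cas u (a # p) v) \<longleftrightarrow> tail X a = u \<and> (\<exists>v. cas (head X a) p v)"
      by simp
    then show ?case
      unfolding Cons.IH by (auto simp: successively_Cons)
  qed auto
  have "(\<exists>u v. awalk u p v) \<longleftrightarrow> set p \<subseteq> arcs X \<and> (\<exists>u\<in>verts X. \<exists>v. cas u p v)"
    unfolding awalk_def by blast
  moreover have "tail X (hd p) \<in> verts X" if "p \<noteq> []" "set p \<subseteq> arcs X"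
    using that by (cases p) auto
  ultimately show ?thesis
    unfolding free_semigroupoid_def cas by auto
qed

lemma paths_append_iff:
  assumes "wf_digraph X" "p \<noteq> []" "q \<noteq> []"
  shows "p @ q \<in> arcs (free_semigroupoid X) \<longleftrightarrow>
    p \<in> arcs (free_semigroupoid X) \<and> q \<in> arcs (free_semigroupoid X) \<and> head X (last p) = tail X (hd q)"
  using assms(2,3) by (auto simp: paths_iff[OF assms(1)] successively_append_iff)

lemma singleton_path_iff:
  "wf_digraph X \<Longrightarrow> [a] \<in> arcs (free_semigroupoid X) \<longleftrightarrow> a \<in> arcs X"
  by (simp add: paths_iff)

subsection \<open>Automatic structures on semigroups\<close>

text \<open>A semigroup may lack an identity, so the product is meaningful on non-empty lists
  only.\<close>

fun list_prod :: "('c \<Rightarrow> 'c \<Rightarrow> 'c) \<Rightarrow> 'c list \<Rightarrow> 'c" where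
  "list_prod m [x] = x"
| "list_prod m (x # y # ys) = m x (list_prod m (y # ys))"
| "list_prod m [] = undefined"

lemma list_prod_Cons: "xs \<noteq> [] \<Longrightarrow> list_prod m (x # xs) = m x (list_prod m xs)"
  by (cases xs) auto

context
  fixes C :: "'c set" and m :: "'c \<Rightarrow> 'c \<Rightarrow> 'c"
  assumes semigroup: "semigroupoid (semigroup_as_semigroupoid C m)"
begin

lemma semigroup_closed: "x \<in> C \<Longrightarrow> y \<in> C \<Longrightarrow> m x y \<in> C"
  using semigroupoid.mult_closed[OF semigroup] by (simp add: semigroup_as_semigroupoid_def)

lemma semigroup_assoc: "x \<in> C \<Longrightarrow> y \<in> C \<Longrightarrow> z \<in> C \<Longrightarrow> m x (m y z) = m (m x y) z"
  using semigroupoid.mult_assoc[OF semigroup] by (simp add: semigroup_as_semigroupoid_def)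

lemma list_prod_closed: "xs \<noteq> [] \<Longrightarrow> set xs \<subseteq> C \<Longrightarrow> list_prod m xs \<in> C"
proof (induction xs rule: list_nonempty_induct)
  case (cons x xs)
  then show ?case by (simp add: list_prod_Cons semigroup_closed)
qed simp

lemma list_prod_append:
  assumes "xs \<noteq> []" "ys \<noteq> []" "set xs \<subseteq> C" "set ys \<subseteq> C"
  shows "list_prod m (xs @ ys) = m (list_prod m xs) (list_prod m ys)"
  using assms
proof (induction xs rule: list_nonempty_induct)
  case (single x)
  then show ?case by (simp add: list_prod_Cons)
next
  case (cons x xs)
  then show ?case
    by (simp add: list_prod_Cons semigroup_assoc list_prod_closed)
qed

text \<open>Over a graph with one vertex every non-empty word is a path, so automaticity reduces to
  recognizability over a finite alphabet of any type, renamed into \<open>nat\<close> by an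
  injection. Distinct letters may have the same value under \<open>val\<close>, which leaves room
  for tags.\<close>

lemma automatic_semigroupI:
  fixes A :: "'y set" and val :: "'y \<Rightarrow> 'c"
  defines "ev \<equiv> \<lambda>w. list_prod m (map val w)"
  assumes A: "finite A" "val ` A \<subseteq> C"
    and L: "L \<subseteq> lists A - {[]}" "ev ` L = C"
    and edge: "\<And>a. a \<in> A \<Longrightarrow>
      recognizable (saturated_convolution {(u, v) \<in> L \<times> L. m (ev u) (val a) = ev v})"
    and vertex: "recognizable (saturated_convolution {(u, v) \<in> L \<times> L. ev u = ev v})"
  shows "automatic (semigroup_as_semigroupoid C m)"
proof -
  let ?M = "semigroup_as_semigroupoid C m"
  obtain f :: "'y \<Rightarrow> nat" where f: "inj_on f A"
    using finite_imp_inj_to_nat_seg[OF A(1)] by blast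
  define g where "g = the_inv_into A f"
  have g: "g (f y) = y" if "y \<in> A" for y
    using that by (simp add: g_def the_inv_into_f_f[OF f])
  have gf: "map g (map f u) = u" if "u \<in> lists A" for u
    using that by (induction u) (auto simp: g)
  define X :: "(unit, nat) pre_digraph" where
    "X = \<lparr>verts = {()}, arcs = f ` A, tail = (\<lambda>_. ()), head = (\<lambda>_. ())\<rparr>"
  have X: "fin_digraph X"
    by standard (auto simp: X_def A)
  then have wf: "wf_digraph X"
    by (simp add: fin_digraph_def)
  have paths: "arcs (free_semigroupoid X) = lists (f ` A) - {[]}"
    by (rule set_eqI, unfold paths_iff[OF wf]) (auto simp: X_def successively_conv_nth)
  define \<rho> where "\<rho> w = ev (map g w)" for w
  have \<rho>: "\<rho> (map f u) = ev u" if "u \<in> lists A" for u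
    using gf[OF that] by (simp add: \<rho>_def del: map_map)
  have gA: "map g w \<in> lists A" if "w \<in> lists (f ` A)" for w
    using that by (induction w) (auto simp: g)
  have val_sub: "set (map val u) \<subseteq> C" if "u \<in> lists A" for u
    using that A(2) by auto
  have ev_append: "ev (u @ v) = m (ev u) (ev v)" if "u \<in> lists A" "v \<in> lists A" "u \<noteq> []" "v \<noteq> []" for u v
    using that val_sub[of u] val_sub[of v] by (simp add: ev_def list_prod_append)
  have ev_closed: "ev u \<in> C" if "u \<in> lists A" "u \<noteq> []" for u
    using that val_sub[of u] unfolding ev_def by (intro list_prod_closed) auto
  have LA: "u \<in> lists A" "u \<noteq> []" if "u \<in> L" for u
    using that L(1) by auto
  define K where "K = map f ` L"
  have K: "K \<subseteq> arcs (free_semigroupoid X)"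
    using LA by (fastforce simp: K_def paths)
  have \<rho>_K: "\<rho> ` K = C"
  proof -
    have "\<rho> ` K = ev ` L"
      unfolding K_def image_image by (intro image_cong) (simp_all add: \<rho> LA)
    then show ?thesis by (simp add: L(2))
  qed
  have choice: "choice_of_representatives ?M X K \<rho>"
  proof (intro choice_of_representatives.intro choice_of_representatives_axioms.intro)
    show "semigroupoid ?M" by (rule semigroup)
    show "wf_digraph X" by (rule wf)
    show "verts X = verts ?M" by (simp add: X_def semigroup_as_semigroupoid_def)
    have \<rho>_closed: "\<rho> w \<in> C" if "w \<in> arcs (free_semigroupoid X)" for w
      using that gA[of w] ev_closed[of "map g w"] by (auto simp: \<rho>_def paths)
    show "semigroupoid_hom (free_semigroupoid X) ?M (\<lambda>v. v) \<rho>"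
      unfolding semigroupoid_hom_def
    proof (intro conjI ballI impI)
      fix u v assume "u \<in> arcs (free_semigroupoid X)" "v \<in> arcs (free_semigroupoid X)"
      then show "\<rho> (mult (free_semigroupoid X) u v) = mult ?M (\<rho> u) (\<rho> v)"
        using ev_append[OF gA[of u] gA[of v]]
        by (simp add: paths semigroup_as_semigroupoid_def \<rho>_def) (simp add: free_semigroupoid_def)
    qed (use \<rho>_closed in \<open>auto simp: semigroup_as_semigroupoid_def\<close>)
    show "\<rho> ` arcs (free_semigroupoid X) = arcs ?M"
      using K \<rho>_K \<rho>_closed by (auto simp: semigroup_as_semigroupoid_def)
    show "K \<subseteq> arcs (free_semigroupoid X)" by (rule K)
    show "\<rho> ` K = arcs ?M"
      using \<rho>_K by (simp add: semigroup_as_semigroupoid_def)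
  qed
  have sync: "synchronously_regular X ((\<lambda>(u, v). (map f u, map f v)) ` R)"
    if R: "R \<subseteq> L \<times> L" "recognizable (saturated_convolution R)" for R
  proof -
    \<comment> \<open>With a single vertex there is only one padding symbol, so the blank translates
      back to \<open>Dollar ()\<close> without loss.\<close>
    let ?k = "\<lambda>x. case x of None \<Rightarrow> Dollar () | Some y \<Rightarrow> Edge (f y)"
    have pad: "pad_to X n (map f u) = map ?k (padded n u)" for n u
      by (simp add: pad_to_def padded_def X_def)
    have image: "pad_pair X ` (\<lambda>(u, v). (map f u, map f v)) ` R = map (map_prod ?k ?k) ` convolution R"
      unfolding convolution_def image_image padded_zip_def map_map_prod_zip
      by (intro image_cong) (auto simp: pad_pair_def Let_def pad)
    have "recognizable (convolution R)"
      using R(2) by (simp add: recognizable_saturated_convolution_iff)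
    then have rec: "recognizable (pad_pair X ` (\<lambda>(u, v). (map f u, map f v)) ` R)"
      unfolding image by (rule recognizable_map_image)
    have pad_sub: "set (pad_to X n (map f u)) \<subseteq> arcs (padded_graph X)" if "u \<in> lists A" for n u
      using that by (auto simp: pad_to_def padded_graph_def X_def)
    have alphabet: "pad_pair X ` (\<lambda>(u, v). (map f u, map f v)) ` R
        \<subseteq> lists (arcs (graph_prod (padded_graph X) (padded_graph X)))"
    proof clarify
      fix u v x y
      assume "(u, v) \<in> R" and xy: "(x, y) \<in> set (pad_pair X (map f u, map f v))"
      with R(1) have "u \<in> lists A" "v \<in> lists A" using LA by auto
      moreover obtain n where "(x, y) \<in> set (zip (pad_to X n (map f u)) (pad_to X n (map f v)))"
        using xy by (auto simp: pad_pair_def Let_def)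
      ultimately have "x \<in> arcs (padded_graph X)" "y \<in> arcs (padded_graph X)"
        using pad_sub set_zip_leftD set_zip_rightD by (metis subsetD)+
      then show "(x, y) \<in> arcs (graph_prod (padded_graph X) (padded_graph X))"
        by (simp add: graph_prod_def)
    qed
    have "finite (arcs (graph_prod (padded_graph X) (padded_graph X)))"
      by (simp add: graph_prod_def padded_graph_def X_def A)
    moreover have "(\<lambda>(u, v). (map f u, map f v)) ` R
        \<subseteq> arcs (free_semigroupoid X) \<times> arcs (free_semigroupoid X)"
      using R(1) K by (auto simp: K_def)
    ultimately show ?thesis
      unfolding synchronously_regular_def
      using regular_language_if_recognizable[OF _ alphabet rec] by blast
  qed
  have edge': "synchronously_regular X (edge_relation X K \<rho> e)" if "e \<in> arcs X" for e
  proof -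
    from that obtain a where a: "a \<in> A" "e = f a" by (auto simp: X_def)
    have "\<rho> (map f u @ [f a]) = m (ev u) (val a)" if "u \<in> L" for u
    proof -
      have "\<rho> (map f (u @ [a])) = ev (u @ [a])"
        using LA[OF that] a by (intro \<rho>) auto
      then show ?thesis
        using LA[OF that] a ev_append[of u "[a]"] by (auto simp: ev_def)
    qed
    then have "edge_relation X K \<rho> e
        = (\<lambda>(u, v). (map f u, map f v)) ` {(u, v) \<in> L \<times> L. m (ev u) (val a) = ev v}"
      unfolding edge_relation_def K_def a(2)
      by (auto simp: \<rho> LA image_iff free_semigroupoid_def)
    then show ?thesis
      using sync[OF _ edge[OF a(1)]] by auto
  qed
  have vertex': "synchronously_regular X (vertex_relation X K \<rho> s)" for s
  proof -
    have "vertex_relation X K \<rho> s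
        = (\<lambda>(u, v). (map f u, map f v)) ` {(u, v) \<in> L \<times> L. ev u = ev v}"
      unfolding vertex_relation_def K_def
      by (auto simp: \<rho> LA image_iff free_semigroupoid_def)
    then show ?thesis
      using sync[OF _ vertex] by auto
  qed
  show ?thesis
    unfolding automatic_def automatic_structure_def
    using choice X edge' vertex' by blast
qed

end

subsection \<open>Encoding by blocks\<close>

text \<open>The block length is \<open>Suc k\<close>, so it is never zero and the recursion
  terminates. The final remainder, of length at most \<open>k\<close> and possibly empty, is
  unconstrained.\<close>

fun blocks_in :: "nat \<Rightarrow> ('e list \<Rightarrow> bool) \<Rightarrow> 'e list \<Rightarrow> bool" where
  "blocks_in k Q u =
     (if length u \<le> k then True else Q (take (Suc k) u) \<and> blocks_in k Q (drop (Suc k) u))"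

declare blocks_in.simps [simp del]

lemma concat_map_zip:
  assumes "length xs = length ys" "\<And>x. x \<in> set xs \<Longrightarrow> length (f x) = n" "\<And>y. y \<in> set ys \<Longrightarrow> length (g y) = n"
  shows "concat (map (\<lambda>(x, y). zip (f x) (g y)) (zip xs ys)) = zip (concat (map f xs)) (concat (map g ys))"
  using assms by (induction xs ys rule: list_induct2) auto

lemma free_semigroupoid_sel:
  "tail (free_semigroupoid X) p = tail X (hd p)" "head (free_semigroupoid X) p = head X (last p)"
  "mult (free_semigroupoid X) = (@)"
  by (simp_all add: free_semigroupoid_def)

section \<open>Right multiplication on representatives\<close>

context choice_of_representatives
begin

lemma \<rho>_path:
  assumes "u \<in> arcs (free_semigroupoid X)"
  shows "\<rho> u \<in> arcs S" "tail S (\<rho> u) = tail X (hd u)" "head S (\<rho> u) = head X (last u)"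
  using assms hom unfolding semigroupoid_hom_def by (auto simp: free_semigroupoid_sel)

lemma wf_X: "wf_digraph X"
  by unfold_locales

lemma \<rho>_append:
  assumes "u @ v \<in> arcs (free_semigroupoid X)" "u \<noteq> []" "v \<noteq> []"
  shows "\<rho> (u @ v) = mult S (\<rho> u) (\<rho> v)"
proof -
  have "u \<in> arcs (free_semigroupoid X)" "v \<in> arcs (free_semigroupoid X)" "head X (last u) = tail X (hd v)"
    using assms paths_append_iff[OF wf_X] by blast+
  then show ?thesis
    using hom unfolding semigroupoid_hom_def by (simp add: free_semigroupoid_sel)
qed

text \<open>Extends \<open>edge_relation\<close> from edges of \<open>X\<close> to arbitrary arrows
  of \<open>S\<close>.\<close>

definition right_relation :: "'a \<Rightarrow> ('e list \<times> 'e list) set" where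
  "right_relation t = {(u, v) \<in> K \<times> K. head X (last u) = tail S t \<and> mult S (\<rho> u) t = \<rho> v}"

text \<open>Since \<open>K\<close> represents every arrow, the intermediate product by
  \<open>s\<close> has a representative in \<open>K\<close>; that word is the middle of the
  composite.\<close>

lemma right_relation_mult:
  assumes "s \<in> arcs S" "t \<in> arcs S" "head S s = tail S t"
  shows "right_relation (mult S s t) = right_relation s O right_relation t"
proof (intro equalityI subsetI)
  fix r assume "r \<in> right_relation (mult S s t)"
  then obtain u v where r: "r = (u, v)" "u \<in> K" "v \<in> K" "head X (last u) = tail S s"
    "mult S (\<rho> u) (mult S s t) = \<rho> v"
    using assms by (auto simp: right_relation_def tail_mult)
  have u: "\<rho> u \<in> arcs S" "head S (\<rho> u) = tail S s"
    using r(2,4) K_subset \<rho>_path by auto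
  then have "mult S (\<rho> u) s \<in> \<rho> ` K"
    using assms mult_closed image_K by simp
  then obtain w where w: "w \<in> K" "\<rho> w = mult S (\<rho> u) s"
    by (metis imageE)
  have "head X (last w) = tail S t"
    using w u assms K_subset \<rho>_path(3)[of w] by (auto simp: head_mult)
  moreover have "mult S (\<rho> w) t = \<rho> v"
    using w(2) r(5) u assms by (simp add: mult_assoc)
  ultimately show "r \<in> right_relation s O right_relation t"
    using r w by (auto simp: right_relation_def)
next
  fix r assume "r \<in> right_relation s O right_relation t"
  then obtain u w v where r: "r = (u, v)" "u \<in> K" "v \<in> K" "head X (last u) = tail S s"
    "mult S (\<rho> u) s = \<rho> w" "mult S (\<rho> w) t = \<rho> v"
    by (auto simp: right_relation_def)
  have u: "\<rho> u \<in> arcs S" "head S (\<rho> u) = tail S s"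
    using r(2,4) K_subset \<rho>_path by auto
  then have "mult S (\<rho> u) (mult S s t) = \<rho> v"
    using r(5,6) assms by (simp add: mult_assoc)
  then show "r \<in> right_relation (mult S s t)"
    using r assms by (auto simp: right_relation_def tail_mult)
qed

lemma right_relation_edge:
  assumes "a \<in> arcs X"
  shows "right_relation (\<rho> [a]) = edge_relation X K \<rho> a"
proof -
  have a: "[a] \<in> arcs (free_semigroupoid X)"
    using assms by (simp add: singleton_path_iff[OF wf_X])
  have "\<rho> (u @ [a]) = mult S (\<rho> u) (\<rho> [a])" if "u \<in> K" "head X (last u) = tail X a" for u
  proof -
    have u: "u \<in> arcs (free_semigroupoid X)"
      using that(1) K_subset by blast
    then have "u \<noteq> []"
      by (simp add: paths_iff[OF wf_X])
    with u have "u @ [a] \<in> arcs (free_semigroupoid X)"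
      using a that(2) by (simp add: paths_append_iff[OF wf_X])
    then show ?thesis
      using \<open>u \<noteq> []\<close> by (simp add: \<rho>_append)
  qed
  then show ?thesis
    unfolding right_relation_def edge_relation_def using \<rho>_path(2)[OF a]
    by (auto simp: free_semigroupoid_sel)
qed

text \<open>By surjectivity \<open>t\<close> is the value of a path, and induction on that path
  turns the relation into a composite of edge relations.\<close>

lemma recognizable_right_relation:
  assumes "\<And>a. a \<in> arcs X \<Longrightarrow> recognizable (saturated_convolution (edge_relation X K \<rho> a))"
    and "t \<in> arcs S"
  shows "recognizable (saturated_convolution (right_relation t))"
proof -
  have "recognizable (saturated_convolution (right_relation (\<rho> q)))"
    if "q \<in> arcs (free_semigroupoid X)" for q
    using that
  proof (induction q rule: rev_induct)
    case Nil
    then show ?case by (simp add: paths_iff[OF wf_X])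
  next
    case (snoc a q)
    then have a: "a \<in> arcs X"
      by (simp add: paths_iff[OF wf_X])
    show ?case
    proof (cases "q = []")
      case True
      then show ?thesis using assms(1) a by (simp add: right_relation_edge)
    next
      case False
      then have q: "q \<in> arcs (free_semigroupoid X)" "[a] \<in> arcs (free_semigroupoid X)"
        "head X (last q) = tail X a"
        using snoc.prems paths_append_iff[OF wf_X, of q "[a]"] by auto
      then have "right_relation (\<rho> (q @ [a])) = right_relation (\<rho> q) O right_relation (\<rho> [a])"
        using False snoc.prems by (simp add: \<rho>_append \<rho>_path right_relation_mult)
      then show ?thesis
        using snoc.IH[OF q(1)] assms(1)[OF a] by (simp add: right_relation_edge[OF a] recognizable_relcomp)
    qed
  qed
  then show ?thesis
    using assms(2) surj by force
qed

end

text \<open>\<open>Suc k\<close> is the block length. Each \<open>x\<close> in \<open>V\<close>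
  comes with a chosen factorization into \<open>b x\<close>, the matrix entry at
  \<open>(l x, j x)\<close>, and \<open>c x\<close>; \<open>cover\<close> supplies representatives
  whose full blocks all have values in \<open>V\<close>.\<close>

locale rees_encoding = rees_data S I \<Lambda> F G P + choice_of_representatives S X K \<rho>
  for S :: "('o, 'a) semigroupoid" and I :: "'i set" and \<Lambda> :: "'l set"
    and F :: "'i \<Rightarrow> 'o" and G :: "'l \<Rightarrow> 'o" and P :: "'l \<Rightarrow> 'i \<Rightarrow> 'a option"
    and X :: "('o, 'e) pre_digraph" and K :: "'e list set" and \<rho> :: "'e list \<Rightarrow> 'a" +
  fixes k :: nat and V :: "'a set"
    and b :: "'a \<Rightarrow> 'a" and l :: "'a \<Rightarrow> 'l" and j :: "'a \<Rightarrow> 'i" and c :: "'a \<Rightarrow> 'a"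
  assumes semigroup: "semigroupoid (rees_semigroup S I \<Lambda> F G P)"
    and finite_I: "finite I" and finite_\<Lambda>: "finite \<Lambda>" and finite_X: "finite (arcs X)"
    and edge_recognizable:
      "\<And>a. a \<in> arcs X \<Longrightarrow> recognizable (saturated_convolution (edge_relation X K \<rho> a))"
    and vertex_recognizable:
      "\<And>s. s \<in> verts X \<Longrightarrow> recognizable (saturated_convolution (vertex_relation X K \<rho> s))"
    and factors: "\<And>x. x \<in> V \<Longrightarrow> b x \<in> arcs S \<and> c x \<in> arcs S \<and> l x \<in> \<Lambda> \<and> j x \<in> I \<and>
      head S (b x) = G (l x) \<and> tail S (c x) = F (j x) \<and>
      (\<exists>p. P (l x) (j x) = Some p \<and> x = mult S (mult S (b x) p) (c x))"
    and cover: "\<And>x. x \<in> arcs S \<Longrightarrow> \<exists>u\<in>K. blocks_in k (\<lambda>B. \<rho> B \<in> V) u \<and> \<rho> u = x"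
begin

text \<open>\<open>None\<close> is a formal identity, which \<open>S\<close> may lack: nothing is
  pending before the first block.\<close>

definition left_mult :: "'a option \<Rightarrow> 'a \<Rightarrow> 'a" where
  "left_mult d y = (case d of None \<Rightarrow> y | Some d' \<Rightarrow> mult S d' y)"

text \<open>The middle entry of the last letter. If the last full block exhausts the word, the
  remainder is empty and only the pending factor is left.\<close>

definition pending_value :: "'a option \<Rightarrow> 'e list \<Rightarrow> 'a" where
  "pending_value d u = (if u = [] then the d else left_mult d (\<rho> u))"

text \<open>A block of length at most \<open>k\<close> is the final remainder and closes with the
  index \<open>\<kappa>\<close>. A full block emits only the part \<open>b\<close> of its value; the
  matrix entry is supplied by the Rees product, and \<open>c\<close> passes to the next
  state.\<close>

definition letter :: "'l \<Rightarrow> 'i \<times> 'a option \<Rightarrow> 'e list \<Rightarrow> ('i \<times> 'a \<times> 'l) option \<times> 'e list" where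
  "letter \<kappa> s B =
     (if length B \<le> k then (Some (fst s, pending_value (snd s) B, \<kappa>), B)
      else (Some (fst s, left_mult (snd s) (b (\<rho> B)), l (\<rho> B)), B))"

definition next_state :: "'e list \<Rightarrow> 'i \<times> 'a option" where
  "next_state B = (j (\<rho> B), Some (c (\<rho> B)))"

text \<open>In the state \<open>(i, Some d)\<close> the factor \<open>d\<close> is left over from the previous block. Every letter is an
  element of the Rees matrix semigroup tagged with the block that it consumes; the tags make the
  encoding injective and readable by an automaton.\<close>

fun encode :: "'l \<Rightarrow> 'i \<times> 'a option \<Rightarrow> 'e list \<Rightarrow> (('i \<times> 'a \<times> 'l) option \<times> 'e list) list" where
  "encode \<kappa> s u =
     (if length u \<le> k then [letter \<kappa> s u]
      else letter \<kappa> s (take (Suc k) u) # encode \<kappa> (next_state (take (Suc k) u)) (drop (Suc k) u))"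

declare encode.simps [simp del]

section \<open>Decoding, and regularity of the set of encodings\<close>

lemma snd_letter [simp]: "snd (letter \<kappa> s B) = B"
  by (simp add: letter_def)

lemma encode_not_Nil [simp]: "encode \<kappa> s u \<noteq> []"
  by (subst encode.simps) simp

lemma snd_hd_encode: "snd (hd (encode \<kappa> s u)) = take (Suc k) u"
  by (subst encode.simps) simp

lemma length_snd_encode: "y \<in> set (encode \<kappa> s u) \<Longrightarrow> length (snd y) \<le> Suc k"
proof (induction \<kappa> s u rule: encode.induct)
  case (1 \<kappa> s u)
  from "1.prems" show ?case
    by (subst (asm) encode.simps) (auto split: if_splits intro: "1.IH")
qed

text \<open>All tags but the last are full blocks, so padding each tag to \<open>Suc k\<close>
  creates blanks only at the end of the word.\<close>

lemma decode_encode: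
  "concat (map (\<lambda>y. padded (Suc k) (snd y)) (encode \<kappa> s u)) = padded (length (encode \<kappa> s u) * Suc k) u
    \<and> length u \<le> length (encode \<kappa> s u) * Suc k"
proof (induction \<kappa> s u rule: encode.induct)
  case (1 \<kappa> s u)
  show ?case
  proof (cases "length u \<le> k")
    case True
    then show ?thesis by (simp add: encode.simps)
  next
    case False
    define n where "n = length (encode \<kappa> (next_state (take (Suc k) u)) (drop (Suc k) u))"
    have enc: "encode \<kappa> s u
        = letter \<kappa> s (take (Suc k) u) # encode \<kappa> (next_state (take (Suc k) u)) (drop (Suc k) u)"
      using False by (subst encode.simps) simp
    have len: "length u - Suc k \<le> n * Suc k"
      using "1.IH"[OF False] by (simp add: n_def)
    have "map Some u = map Some (take (Suc k) u) @ map Some (drop (Suc k) u)"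
      by (metis append_take_drop_id map_append)
    then have "padded (Suc n * Suc k) u = map Some (take (Suc k) u) @ padded (n * Suc k) (drop (Suc k) u)"
      using False len by (simp add: padded_def algebra_simps)
    moreover have "padded (Suc k) (take (Suc k) u) = map Some (take (Suc k) u)"
      using False by (simp add: padded_def)
    moreover have "length u \<le> Suc n * Suc k"
      using False len by simp
    ultimately show ?thesis
      unfolding enc using "1.IH"[OF False] by (simp add: n_def)
  qed
qed

text \<open>A blank letter also expands to \<open>Suc k\<close> blanks, which keeps the two tracks
  of a convolution aligned after expansion.\<close>

definition unpack :: "(('i \<times> 'a \<times> 'l) option \<times> 'e list) option \<Rightarrow> 'e option list" where
  "unpack y = (case y of None \<Rightarrow> replicate (Suc k) None | Some z \<Rightarrow> padded (Suc k) (snd z))"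

lemma unpack_encode:
  assumes "length (encode \<kappa> s u) \<le> n"
  shows "concat (map unpack (padded n (encode \<kappa> s u))) = padded (n * Suc k) u" "length u \<le> n * Suc k"
proof -
  let ?m = "length (encode \<kappa> s u)"
  have le: "?m * Suc k \<le> n * Suc k"
    using assms by (rule mult_le_mono1)
  then show "length u \<le> n * Suc k"
    using decode_encode[of \<kappa> s u] by linarith
  have "concat (replicate i (replicate (Suc k) None)) = replicate (i * Suc k) (None :: 'e option)" for i
    by (induction i) (auto simp: replicate_add[symmetric])
  then have "concat (map unpack (padded n (encode \<kappa> s u)))
      = padded (?m * Suc k) u @ replicate ((n - ?m) * Suc k) None"
    using decode_encode[of \<kappa> s u] by (simp add: padded_def[of n] unpack_def comp_def del: replicate.simps)
  also have "\<dots> = padded (?m * Suc k + (n - ?m) * Suc k) u"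
    using decode_encode[of \<kappa> s u] by (simp only: padded_add)
  also have "?m * Suc k + (n - ?m) * Suc k = n * Suc k"
    using assms by (metis add_mult_distrib le_add_diff_inverse)
  finally show "concat (map unpack (padded n (encode \<kappa> s u))) = padded (n * Suc k) u" .
qed

lemma length_unpack_encode: "x \<in> set (padded n (encode \<kappa> s u)) \<Longrightarrow> length (unpack x) = Suc k"
  by (auto simp: padded_def unpack_def dest: length_snd_encode split: if_splits)

abbreviation unpack_pairs where
  "unpack_pairs W \<equiv> concat (map (\<lambda>(x, y). zip (unpack x) (unpack y)) W)"

lemma unpack_pairs_encode:
  assumes "length (encode \<kappa> s u) \<le> n" "length (encode \<mu> t v) \<le> n"
  shows "unpack_pairs (padded_zip n (encode \<kappa> s u, encode \<mu> t v)) = padded_zip (n * Suc k) (u, v)"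
proof -
  have "unpack_pairs (padded_zip n (encode \<kappa> s u, encode \<mu> t v)) =
    zip (concat (map unpack (padded n (encode \<kappa> s u)))) (concat (map unpack (padded n (encode \<mu> t v))))"
    unfolding padded_zip_def fst_conv snd_conv
    by (rule concat_map_zip) (use assms length_unpack_encode in auto)
  then show ?thesis
    using assms by (simp only: unpack_encode padded_zip_def fst_conv snd_conv)
qed

text \<open>One pair of letters expands to \<open>Suc k\<close> pairs of edges, so the condition on
  \<open>R\<close> becomes an inverse image under a morphism, while the product relation ensures
  that both tracks are encodings. Saturation is essential: \<open>n * Suc k\<close> may exceed the
  minimal length.\<close>

lemma saturated_convolution_encode:
  "saturated_convolution {(encode \<kappa> s u, encode \<mu> t v) | u v. (u, v) \<in> R \<and> u \<in> U \<and> v \<in> U'} =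
     saturated_convolution (encode \<kappa> s ` U \<times> encode \<mu> t ` U') \<inter>
     {W. unpack_pairs W \<in> saturated_convolution R}" (is "?L = ?A \<inter> ?B")
proof (intro equalityI subsetI)
  fix W assume "W \<in> ?L"
  then obtain n u v where W: "W = padded_zip n (encode \<kappa> s u, encode \<mu> t v)"
    and uv: "(u, v) \<in> R" "u \<in> U" "v \<in> U'"
    and le: "length (encode \<kappa> s u) \<le> n" "length (encode \<mu> t v) \<le> n"
    unfolding saturated_convolution_def by blast
  have "unpack_pairs W = padded_zip (n * Suc k) (u, v)"
    unfolding W by (rule unpack_pairs_encode[OF le])
  then have "W \<in> ?B"
    using uv(1) unpack_encode(2)[OF le(1)] unpack_encode(2)[OF le(2)]
    unfolding saturated_convolution_def by blast
  moreover have "W \<in> ?A"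
    using W uv le unfolding saturated_convolution_def by blast
  ultimately show "W \<in> ?A \<inter> ?B" by (rule IntI[rotated])
next
  fix W assume "W \<in> ?A \<inter> ?B"
  then obtain n u v where W: "W = padded_zip n (encode \<kappa> s u, encode \<mu> t v)"
    and uv: "u \<in> U" "v \<in> U'"
    and le: "length (encode \<kappa> s u) \<le> n" "length (encode \<mu> t v) \<le> n"
    and "W \<in> ?B"
    unfolding saturated_convolution_def by blast
  then obtain n' u' v' where *: "unpack_pairs W = padded_zip n' (u', v')" "(u', v') \<in> R"
    "length u' \<le> n'" "length v' \<le> n'"
    unfolding saturated_convolution_def by blast
  have "padded_zip (n * Suc k) (u, v) = padded_zip n' (u', v')"
    using unpack_pairs_encode[OF le] *(1) W by simp
  then have "padded (n * Suc k) u = padded n' u'" "padded (n * Suc k) v = padded n' v'"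
    using map_padded_zip[OF *(3,4)] map_padded_zip[OF unpack_encode(2)[OF le(1)] unpack_encode(2)[OF le(2)]]
    by metis+
  then have "u = u'" "v = v'"
    by (auto dest: padded_inj)
  then show "W \<in> ?L"
    using W uv le *(2) unfolding saturated_convolution_def by blast
qed

text \<open>Neither membership in \<open>K\<close> nor composability of the edges is demanded, so
  that residuals of the encodings depend on the encoding state alone. Both conditions enter later
  through relations on \<open>K\<close>.\<close>

definition admissible :: "'e list set" where
  "admissible = {u \<in> lists (arcs X). blocks_in k (\<lambda>B. \<rho> B \<in> V) u}"

definition short_words :: "'e list set" where
  "short_words = {B. set B \<subseteq> arcs X \<and> length B \<le> Suc k}"

lemma finite_short_words: "finite short_words"
  unfolding short_words_def using finite_X by (rule finite_lists_length_le)

text \<open>This is a transition function: the tag of \<open>y\<close> reveals the block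
  \<open>B\<close>, hence the only letter possible in state \<open>s\<close>. After a remainder
  nothing may follow; after a full block the new state depends on \<open>B\<close> alone.\<close>

lemma residual_encode:
  "residual (encode \<kappa> s ` admissible) [y] =
     (let B = snd y in
      if y \<noteq> letter \<kappa> s B \<or> B \<notin> short_words then {}
      else if length B \<le> k then {[]}
      else if \<rho> B \<in> V then encode \<kappa> (next_state B) ` admissible else {})" (is "_ = ?r")
proof (intro equalityI subsetI)
  fix w assume "w \<in> residual (encode \<kappa> s ` admissible) [y]"
  then obtain u where u: "y # w = encode \<kappa> s u" "set u \<subseteq> arcs X" "blocks_in k (\<lambda>B. \<rho> B \<in> V) u"
    by (auto simp: residual_def admissible_def)
  show "w \<in> ?r"
  proof (cases "length u \<le> k")
    case True
    with u show ?thesis by (simp add: encode.simps short_words_def Let_def)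
  next
    case False
    then have y: "y = letter \<kappa> s (take (Suc k) u)"
      and w: "w = encode \<kappa> (next_state (take (Suc k) u)) (drop (Suc k) u)"
      using u(1) by (simp_all add: encode.simps[of \<kappa> s u])
    have "\<rho> (take (Suc k) u) \<in> V" "blocks_in k (\<lambda>B. \<rho> B \<in> V) (drop (Suc k) u)"
      using False u(3) by (simp_all add: blocks_in.simps[of k _ u])
    moreover have "set (take (Suc k) u) \<subseteq> arcs X" "set (drop (Suc k) u) \<subseteq> arcs X"
      using u(2) set_take_subset set_drop_subset by fast+
    ultimately show ?thesis
      using False unfolding y w by (auto simp: short_words_def admissible_def Let_def)
  qed
next
  fix w assume w: "w \<in> ?r"
  define B where "B = snd y"
  have y: "y = letter \<kappa> s B" "B \<in> short_words"
    using w by (auto simp: B_def Let_def split: if_splits)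
  show "w \<in> residual (encode \<kappa> s ` admissible) [y]"
  proof (cases "length B \<le> k")
    case True
    then have "w = []" using w y by (auto simp: Let_def B_def[symmetric])
    moreover have "B \<in> admissible"
      using y True by (auto simp: admissible_def short_words_def blocks_in.simps)
    moreover have "encode \<kappa> s B = [y]"
      using y True by (simp add: encode.simps)
    ultimately show ?thesis
      unfolding residual_def by force
  next
    case False
    then obtain u where u: "\<rho> B \<in> V" "w = encode \<kappa> (next_state B) u" "u \<in> admissible"
      using w y by (auto simp: Let_def B_def[symmetric] split: if_splits)
    have len: "length B = Suc k"
      using False y(2) by (simp add: short_words_def)
    then have "B @ u \<in> admissible"
      using u y(2) by (auto simp: admissible_def short_words_def blocks_in.simps[of k _ "B @ u"])
    moreover have "encode \<kappa> s (B @ u) = y # w"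
      using u len y(1) by (simp add: encode.simps[of \<kappa> s "B @ u"])
    ultimately show ?thesis
      unfolding residual_def by force
  qed
qed

lemma recognizable_encode: "recognizable (encode \<kappa> s ` admissible)"
proof (rule recognizable_family)
  \<comment> \<open>The states are \<open>s\<close>, the finitely many states reached after a block,
    an accepting end state and a sink.\<close>
  let ?\<F> = "(\<lambda>t. encode \<kappa> t ` admissible) ` insert s (next_state ` short_words) \<union> {{[]}, {}}"
  show "finite ?\<F>"
    using finite_short_words by simp
  show "encode \<kappa> s ` admissible \<in> ?\<F>" by blast
  fix M y assume "M \<in> ?\<F>"
  then consider t where "M = encode \<kappa> t ` admissible" | "M = {[]}" | "M = {}" by blast
  then show "residual M [y] \<in> ?\<F>"
  proof cases
    case 1
    then show ?thesis unfolding 1 residual_encode Let_def by auto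
  qed (auto simp: residual_def)
qed

section \<open>Codes with prescribed outer indices\<close>

abbreviation code :: "'i \<Rightarrow> 'l \<Rightarrow> 'e list \<Rightarrow> (('i \<times> 'a \<times> 'l) option \<times> 'e list) list" where
  "code i \<kappa> \<equiv> encode \<kappa> (i, None)"

definition codable :: "'i \<Rightarrow> 'l \<Rightarrow> 'e list set" where
  "codable i \<kappa> = {u \<in> K. blocks_in k (\<lambda>B. \<rho> B \<in> V) u \<and> tail X (hd u) = F i \<and> head X (last u) = G \<kappa>}"

definition coded_relation where
  "coded_relation i \<kappa> \<mu> R = {(code i \<kappa> u, code i \<mu> v) | u v. (u, v) \<in> R \<and> u \<in> codable i \<kappa> \<and> v \<in> codable i \<mu>}"

text \<open>The conditions that can be tested on the code itself: the source of the word is visible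
  in the tag of the first letter.\<close>

definition startable :: "'i \<Rightarrow> 'e list set" where
  "startable i = {u \<in> admissible. u \<noteq> [] \<and> tail X (hd u) = F i}"

lemma recognizable_code: "recognizable (code i \<kappa> ` startable i)"
proof -
  have "code i \<kappa> ` startable i = code i \<kappa> ` admissible \<inter>
      {w. w \<noteq> [] \<and> (snd (hd w) \<noteq> [] \<and> tail X (hd (snd (hd w))) = F i)}"
    by (auto simp: startable_def snd_hd_encode)
  then show ?thesis
    using recognizable_Int[OF recognizable_encode
        recognizable_hd[of "\<lambda>y. snd y \<noteq> [] \<and> tail X (hd (snd y)) = F i"]] by simp
qed

lemma codable_subset: "codable i \<kappa> \<subseteq> startable i"
  using K_subset by (auto simp: codable_def startable_def admissible_def paths_iff[OF wf_X] subset_iff)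

text \<open>\<open>R\<close> itself forces membership in \<open>K\<close>, and \<open>heads\<close>
  forces the targets, so \<open>codable\<close> can be weakened to \<open>startable\<close>, whose
  codes form a recognizable set.\<close>

lemma recognizable_coded_relation:
  assumes "recognizable (saturated_convolution R)" "R \<subseteq> K \<times> K"
    and heads: "\<And>u v. (u, v) \<in> R \<Longrightarrow> head X (last u) = G \<kappa> \<and> head X (last v) = G \<mu>"
  shows "recognizable (saturated_convolution (coded_relation i \<kappa> \<mu> R))"
proof -
  have "codable i \<nu> = {u \<in> startable i. u \<in> K \<and> head X (last u) = G \<nu>}" for \<nu>
    using codable_subset by (auto simp: codable_def startable_def admissible_def)
  then have "coded_relation i \<kappa> \<mu> R
      = {(code i \<kappa> u, code i \<mu> v) | u v. (u, v) \<in> R \<and> u \<in> startable i \<and> v \<in> startable i}"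
    using assms(2) heads unfolding coded_relation_def by blast
  then have "saturated_convolution (coded_relation i \<kappa> \<mu> R) =
      saturated_convolution (code i \<kappa> ` startable i \<times> code i \<mu> ` startable i) \<inter>
      {W. unpack_pairs W \<in> saturated_convolution R}"
    by (simp only: saturated_convolution_encode)
  then show ?thesis
    by (simp only: recognizable_Int recognizable_saturated_convolution_Times recognizable_code
        recognizable_concat_vimage assms(1))
qed

text \<open>Induction over the blocks: from state \<open>(i, d)\<close> the word \<open>u\<close>
  evaluates to \<open>i\<close>, \<open>d\<close> times the value of \<open>u\<close>, and
  \<open>\<kappa>\<close>. For a full block with value \<open>b p c\<close>, multiplying the letter
  with middle \<open>d b\<close> by the rest, whose middle starts with \<open>c\<close>, inserts
  exactly the entry \<open>p\<close>. The last three assumptions keep all these products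
  composable.\<close>

lemma encode_value:
  assumes "\<kappa> \<in> \<Lambda>" "fst s \<in> I" "blocks_in k (\<lambda>B. \<rho> B \<in> V) u"
    and "u = [] \<or> u \<in> arcs (free_semigroupoid X)"
    and "snd s = None \<Longrightarrow> u \<noteq> [] \<and> tail X (hd u) = F (fst s)"
    and "\<And>d. snd s = Some d \<Longrightarrow> d \<in> arcs S \<and> tail S d = F (fst s) \<and>
      (if u = [] then head S d = G \<kappa> else head S d = tail X (hd u))"
    and "u \<noteq> [] \<Longrightarrow> head X (last u) = G \<kappa>"
  shows "list_prod (rees_mult S P) (map fst (encode \<kappa> s u)) = Some (fst s, pending_value (snd s) u, \<kappa>)
    \<and> fst ` set (encode \<kappa> s u) \<subseteq> rees_carrier S I \<Lambda> F G"
  using assms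
proof (induction \<kappa> s u rule: encode.induct)
  case (1 \<kappa> s u)
  note prems = "1.prems"
  show ?case
  proof (cases "length u \<le> k")
    case True
    then have enc: "encode \<kappa> s u = [(Some (fst s, pending_value (snd s) u, \<kappa>), u)]"
      by (simp add: encode.simps letter_def)
    have "pending_value (snd s) u \<in> arcs S \<and> tail S (pending_value (snd s) u) = F (fst s)
        \<and> head S (pending_value (snd s) u) = G \<kappa>"
      using prems \<rho>_path[of u] by (cases "snd s"; cases "u = []")
        (simp_all add: pending_value_def left_mult_def mult_closed tail_mult head_mult)
    then show ?thesis
      unfolding enc using prems(1,2) by (simp add: rees_carrier_def)
  next
    case False
    define B where "B = take (Suc k) u"
    define u' where "u' = drop (Suc k) u"
    have u: "u = B @ u'" "u \<noteq> []" "B \<noteq> []" and lenB: "\<not> length B \<le> k"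
      using False by (auto simp: B_def u'_def)
    have path: "u \<in> arcs (free_semigroupoid X)"
      using prems(4) u by auto
    have B: "B \<in> arcs (free_semigroupoid X)"
      using path u paths_append_iff[OF wf_X, of B u'] by (cases "u' = []") auto
    have u': "u' \<in> arcs (free_semigroupoid X)" "head X (last B) = tail X (hd u')" if "u' \<noteq> []"
      using path u that paths_append_iff[OF wf_X, of B u'] by auto
    have V: "\<rho> B \<in> V" and blocks': "blocks_in k (\<lambda>B. \<rho> B \<in> V) u'"
      using False prems(3) unfolding B_def u'_def by (simp_all add: blocks_in.simps[of k _ u])
    define x where "x = \<rho> B"
    obtain p where p: "P (l x) (j x) = Some p" "x = mult S (mult S (b x) p) (c x)"
      and bc: "b x \<in> arcs S" "c x \<in> arcs S" "l x \<in> \<Lambda>" "j x \<in> I"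
        "head S (b x) = G (l x)" "tail S (c x) = F (j x)"
      using factors[OF V] unfolding x_def by blast
    have pS: "p \<in> arcs S" "tail S p = G (l x)" "head S p = F (j x)"
      using P_entry[OF bc(3,4) p(1)] by auto
    have bp: "mult S (b x) p \<in> arcs S" "tail S (mult S (b x) p) = tail S (b x)"
      "head S (mult S (b x) p) = F (j x)"
      using bc pS by (simp_all add: mult_closed tail_mult head_mult)
    have "tail S x = tail S (b x)" "head S x = head S (c x)"
      using bp bc by (subst p(2), simp add: tail_mult head_mult)+
    then have ends: "tail S (b x) = tail X (hd u)" "head S (c x) = head X (last B)"
      using \<rho>_path[OF B] u by (simp_all add: x_def)
    \<comment> \<open>The middle entry produced by the remaining letters: \<open>c x\<close> times
      the value of \<open>u'\<close>, or \<open>c x\<close> alone if the block ends the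
      word.\<close>
    define y where "y = pending_value (Some (c x)) u'"
    have y: "y \<in> arcs S" "tail S y = F (j x)"
      using bc ends u' \<rho>_path[of u'] by (cases "u' = []";
        simp add: y_def pending_value_def left_mult_def mult_closed tail_mult)+
    have \<rho>u: "\<rho> u = mult S (mult S (b x) p) y"
    proof (cases "u' = []")
      case True
      then show ?thesis using p(2) u by (simp add: y_def pending_value_def x_def)
    next
      case False
      then have "\<rho> u = mult S x (\<rho> u')"
        using path u by (simp add: \<rho>_append x_def)
      also have "\<dots> = mult S (mult S (mult S (b x) p) (c x)) (\<rho> u')"
        using p(2) by simp
      also have "\<dots> = mult S (mult S (b x) p) (mult S (c x) (\<rho> u'))"
        using bp bc u'[OF False] \<rho>_path[of u'] ends by (simp add: mult_assoc)
      finally show ?thesis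
        using False by (simp add: y_def pending_value_def left_mult_def)
    qed
    have head: "left_mult (snd s) (b x) \<in> arcs S" "tail S (left_mult (snd s) (b x)) = F (fst s)"
      "head S (left_mult (snd s) (b x)) = G (l x)"
      using prems(5,6) bc ends u(2)
      by (cases "snd s"; simp add: left_mult_def mult_closed tail_mult head_mult)+
    have product: "mult S (mult S (left_mult (snd s) (b x)) p) y = pending_value (snd s) u"
      using prems(6) u(2) bc bp pS y ends
      by (cases "snd s"; simp add: pending_value_def left_mult_def \<rho>u mult_assoc)
    have enc: "encode \<kappa> s u = letter \<kappa> s B # encode \<kappa> (next_state B) u'"
      using False by (simp add: encode.simps[of \<kappa> s u] B_def u'_def)
    have letter: "fst (letter \<kappa> s B) = Some (fst s, left_mult (snd s) (b x), l x)"
      using lenB by (simp add: letter_def x_def)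
    have state: "next_state B = (j x, Some (c x))"
      by (simp add: next_state_def x_def)
    have IH: "list_prod (rees_mult S P) (map fst (encode \<kappa> (next_state B) u')) = Some (j x, y, \<kappa>)
        \<and> fst ` set (encode \<kappa> (next_state B) u') \<subseteq> rees_carrier S I \<Lambda> F G"
      unfolding state
    proof (rule "1.IH"[OF False, folded B_def u'_def, unfolded state fst_conv snd_conv, folded y_def])
      show "d \<in> arcs S \<and> tail S d = F (j x) \<and> (if u' = [] then head S d = G \<kappa> else head S d = tail X (hd u'))"
        if "Some (c x) = Some d" for d
        using that bc ends u u' prems(7) by (cases "u' = []") auto
    qed (use blocks' prems(1,7) u u' bc in auto)
    have "Some (fst s, left_mult (snd s) (b x), l x) \<in> rees_carrier S I \<Lambda> F G"
      using head prems(2) bc(3) by (simp add: rees_carrier_def)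
    then show ?thesis
      unfolding enc using IH p(1) by (simp add: list_prod_Cons letter product)
  qed
qed

end

lemma rees_mult_eq_Some:
  "rees_mult S P g h = Some (i, x, n) \<longleftrightarrow>
     (\<exists>y m j z p. g = Some (i, y, m) \<and> h = Some (j, z, n) \<and> P m j = Some p \<and> x = mult S (mult S y p) z)"
  by (cases "(S, P, g, h)" rule: rees_mult.cases) (auto split: option.splits)

section \<open>The automatic structure on the Rees matrix semigroup\<close>

context rees_encoding
begin

abbreviation word_value where
  "word_value w \<equiv> list_prod (rees_mult S P) (map fst w)"

lemma codable_path: "u \<in> codable i \<kappa> \<Longrightarrow> u \<in> K \<and> u \<in> arcs (free_semigroupoid X)"
  using K_subset by (auto simp: codable_def)

lemma code_value:
  assumes "i \<in> I" "\<kappa> \<in> \<Lambda>" "u \<in> codable i \<kappa>"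
  shows "word_value (code i \<kappa> u) = Some (i, \<rho> u, \<kappa>)"
    and "fst ` set (code i \<kappa> u) \<subseteq> rees_carrier S I \<Lambda> F G"
proof -
  have u: "u \<in> arcs (free_semigroupoid X)" "u \<noteq> []"
    using codable_path[OF assms(3)] by (simp_all add: paths_iff[OF wf_X])
  then have "word_value (code i \<kappa> u) = Some (i, pending_value None u, \<kappa>)
      \<and> fst ` set (code i \<kappa> u) \<subseteq> rees_carrier S I \<Lambda> F G"
    using encode_value[of \<kappa> "(i, None)" u] assms by (simp add: codable_def)
  then show "word_value (code i \<kappa> u) = Some (i, \<rho> u, \<kappa>)"
    and "fst ` set (code i \<kappa> u) \<subseteq> rees_carrier S I \<Lambda> F G"
    using u by (simp_all add: pending_value_def left_mult_def)
qed

text \<open>The zero receives a word of its own, and no other code word evaluates to it.\<close>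

definition zero_word :: "(('i \<times> 'a \<times> 'l) option \<times> 'e list) list" where
  "zero_word = [(None, [])]"

definition code_words :: "(('i \<times> 'a \<times> 'l) option \<times> 'e list) list set" where
  "code_words = {zero_word} \<union> (\<Union>i\<in>I. \<Union>\<kappa>\<in>\<Lambda>. code i \<kappa> ` codable i \<kappa>)"

text \<open>An arbitrary combination of state and block may give a triple with mismatched end
  points, hence the intersection with the carrier.\<close>

definition alphabet :: "(('i \<times> 'a \<times> 'l) option \<times> 'e list) set" where
  "alphabet = {y. fst y \<in> rees_carrier S I \<Lambda> F G \<and>
     y \<in> insert (None, []) (\<Union>i\<in>I. \<Union>\<kappa>\<in>\<Lambda>.
       (\<lambda>(t, B). letter \<kappa> t B) ` (insert (i, None) (next_state ` short_words) \<times> short_words))}"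

lemma finite_alphabet: "finite alphabet"
  unfolding alphabet_def using finite_I finite_\<Lambda> finite_short_words by simp

lemma set_encode:
  "set u \<subseteq> arcs X \<Longrightarrow> set (encode \<kappa> s u) \<subseteq>
    (\<lambda>(t, B). letter \<kappa> t B) ` (insert s (next_state ` short_words) \<times> short_words)"
proof (induction \<kappa> s u rule: encode.induct)
  case (1 \<kappa> s u)
  show ?case
  proof (cases "length u \<le> k")
    case True
    then show ?thesis
      using "1.prems" by (subst encode.simps) (auto simp: short_words_def)
  next
    case False
    have "set (take (Suc k) u) \<subseteq> arcs X" and rest: "set (drop (Suc k) u) \<subseteq> arcs X"
      using "1.prems" set_take_subset set_drop_subset by fast+
    then have "take (Suc k) u \<in> short_words"
      by (simp add: short_words_def)
    with "1.IH"[OF False rest] False show ?thesis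
      by (subst encode.simps) auto
  qed
qed

lemma code_words_subset: "code_words \<subseteq> lists alphabet - {[]}"
proof -
  have "set (code i \<kappa> u) \<subseteq> alphabet" if "i \<in> I" "\<kappa> \<in> \<Lambda>" "u \<in> codable i \<kappa>" for i \<kappa> u
  proof -
    have "set u \<subseteq> arcs X"
      using codable_path[OF that(3)] by (simp add: paths_iff[OF wf_X])
    then show ?thesis
      using set_encode[of u \<kappa> "(i, None)"] code_value(2)[OF that] that(1,2)
      unfolding alphabet_def by blast
  qed
  then show ?thesis
    by (auto simp: code_words_def zero_word_def alphabet_def rees_carrier_def)
qed

lemma word_value_zero [simp]: "word_value zero_word = None"
  by (simp add: zero_word_def)

lemma word_value_eq_None: "w \<in> code_words \<Longrightarrow> word_value w = None \<longleftrightarrow> w = zero_word"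
  by (auto simp: code_words_def code_value)

lemma zero_in_code_words: "zero_word \<in> code_words"
  and code_in_code_words: "\<lbrakk>i \<in> I; \<kappa> \<in> \<Lambda>; u \<in> codable i \<kappa>\<rbrakk> \<Longrightarrow> code i \<kappa> u \<in> code_words"
  by (auto simp: code_words_def)

lemma code_words_cases:
  assumes "w \<in> code_words"
  obtains "w = zero_word" | i \<kappa> u where "i \<in> I" "\<kappa> \<in> \<Lambda>" "u \<in> codable i \<kappa>" "w = code i \<kappa> u"
  using assms by (auto simp: code_words_def)

lemma word_value_eq_Some:
  assumes "w \<in> code_words"
  shows "word_value w = Some (i, x, \<kappa>) \<longleftrightarrow>
    i \<in> I \<and> \<kappa> \<in> \<Lambda> \<and> (\<exists>u\<in>codable i \<kappa>. w = code i \<kappa> u \<and> \<rho> u = x)"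
proof
  assume "word_value w = Some (i, x, \<kappa>)"
  with assms show "i \<in> I \<and> \<kappa> \<in> \<Lambda> \<and> (\<exists>u\<in>codable i \<kappa>. w = code i \<kappa> u \<and> \<rho> u = x)"
    by (cases rule: code_words_cases) (auto simp: code_value)
qed (auto simp: code_value)

text \<open>Surjectivity is where \<open>cover\<close> enters: the representative of the middle
  entry has suitable blocks, and its end points match the indices because \<open>\<rho>\<close>
  preserves sources and targets.\<close>

lemma word_value_code_words: "word_value ` code_words = rees_carrier S I \<Lambda> F G"
proof (intro equalityI subsetI)
  fix x assume "x \<in> word_value ` code_words"
  then obtain w where w: "w \<in> code_words" "x = word_value w" by blast
  show "x \<in> rees_carrier S I \<Lambda> F G"
  proof (cases x)
    case None
    then show ?thesis by (simp add: rees_carrier_def)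
  next
    case (Some t)
    obtain i y \<kappa> where "t = (i, y, \<kappa>)" by (rule prod_cases3)
    then have *: "i \<in> I" "\<kappa> \<in> \<Lambda>" "\<exists>u\<in>codable i \<kappa>. \<rho> u = y"
      using word_value_eq_Some[OF w(1), of i y \<kappa>] w(2) Some by auto
    then obtain u where "u \<in> codable i \<kappa>" "\<rho> u = y" by blast
    then have "y \<in> arcs S \<and> F i = tail S y \<and> head S y = G \<kappa>"
      using codable_path[of u i \<kappa>] \<rho>_path[of u] by (auto simp: codable_def)
    then show ?thesis
      using * Some \<open>t = (i, y, \<kappa>)\<close> by (simp add: rees_carrier_def)
  qed
next
  fix x assume "x \<in> rees_carrier S I \<Lambda> F G"
  then consider "x = None" | i y \<kappa> where "x = Some (i, y, \<kappa>)" "i \<in> I" "y \<in> arcs S" "\<kappa> \<in> \<Lambda>"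
    "F i = tail S y" "head S y = G \<kappa>"
    by (auto simp: rees_carrier_def)
  then show "x \<in> word_value ` code_words"
  proof cases
    case 1
    then have "x = word_value zero_word" "zero_word \<in> code_words"
      by (simp_all add: code_words_def)
    then show ?thesis by (rule image_eqI)
  next
    case 2
    obtain u where u: "u \<in> K" "blocks_in k (\<lambda>B. \<rho> B \<in> V) u" "\<rho> u = y"
      using cover[OF 2(3)] by blast
    then have "u \<in> codable i \<kappa>"
      using 2 \<rho>_path[of u] K_subset by (auto simp: codable_def)
    then have "x = word_value (code i \<kappa> u)" "code i \<kappa> u \<in> code_words"
      using 2 u(3) code_value(1) code_in_code_words by simp_all
    then show ?thesis by (rule image_eqI)
  qed
qed

lemma G_in_verts:
  assumes "\<kappa> \<in> \<Lambda>"
  shows "G \<kappa> \<in> verts X"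
proof -
  obtain u where u: "u \<in> arcs (free_semigroupoid X)" "G \<kappa> = head S (\<rho> u)"
    using assms G_surj surj by (metis imageE imageI)
  then have "last u \<in> arcs X"
    by (auto simp: paths_iff[OF wf_X])
  then show ?thesis
    using u \<rho>_path(3) by simp
qed

lemma recognizable_coded_vertex_relation:
  assumes "\<kappa> \<in> \<Lambda>"
  shows "recognizable (saturated_convolution (coded_relation i \<kappa> \<kappa> (vertex_relation X K \<rho> (G \<kappa>))))"
proof (rule recognizable_coded_relation)
  fix u v assume "(u, v) \<in> vertex_relation X K \<rho> (G \<kappa>)"
  then have "u \<in> arcs (free_semigroupoid X)" "v \<in> arcs (free_semigroupoid X)"
    "head X (last u) = G \<kappa>" "\<rho> u = \<rho> v"
    using K_subset by (auto simp: vertex_relation_def free_semigroupoid_sel)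
  then show "head X (last u) = G \<kappa> \<and> head X (last v) = G \<kappa>"
    using \<rho>_path(3)[of u] \<rho>_path(3)[of v] by simp
next
  show "recognizable (saturated_convolution (vertex_relation X K \<rho> (G \<kappa>)))"
    by (rule vertex_recognizable[OF G_in_verts[OF assms]])
qed (auto simp: vertex_relation_def)

text \<open>The coded vertex relation contains the diagonal of the codes in question. Composing it
  with a product relation therefore selects precisely these codes as first components.\<close>

lemma recognizable_code_times_zero:
  assumes "\<kappa> \<in> \<Lambda>"
  shows "recognizable (saturated_convolution (code i \<kappa> ` codable i \<kappa> \<times> {zero_word}))"
proof -
  have "code i \<kappa> ` codable i \<kappa> \<times> {zero_word} =
      coded_relation i \<kappa> \<kappa> (vertex_relation X K \<rho> (G \<kappa>)) O (code i \<kappa> ` startable i \<times> {zero_word})"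
    using codable_subset[of i \<kappa>]
    by (fastforce simp: coded_relation_def vertex_relation_def free_semigroupoid_sel codable_def)
  then show ?thesis
    using recognizable_relcomp[OF recognizable_coded_vertex_relation[OF assms]
        recognizable_saturated_convolution_Times[OF recognizable_code recognizable_singleton]]
    by (simp add: zero_word_def)
qed

lemma recognizable_zero_zero: "recognizable (saturated_convolution {(zero_word, zero_word)})"
  using recognizable_saturated_convolution_Times[OF recognizable_singleton recognizable_singleton]
  by (simp add: zero_word_def)

text \<open>Equal nonzero values have equal outer indices, so the relation is a finite union of
  coded vertex relations and the pair of zero words.\<close>

lemma recognizable_equal_values:
  "recognizable (saturated_convolution {(w, w') \<in> code_words \<times> code_words. word_value w = word_value w'})"
proof -
  have "{(w, w') \<in> code_words \<times> code_words. word_value w = word_value w'} =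
      {(zero_word, zero_word)} \<union>
      (\<Union>i\<in>I. \<Union>\<kappa>\<in>\<Lambda>. coded_relation i \<kappa> \<kappa> (vertex_relation X K \<rho> (G \<kappa>)))" (is "?L = ?R")
  proof (intro equalityI subsetI)
    fix r assume "r \<in> ?L"
    then obtain w w' where r: "r = (w, w')" "w \<in> code_words" "w' \<in> code_words"
      "word_value w = word_value w'" by blast
    show "r \<in> ?R"
    proof (cases "word_value w")
      case None
      then show ?thesis using r by (simp add: word_value_eq_None)
    next
      case (Some t)
      obtain i x \<kappa> where t: "t = (i, x, \<kappa>)" by (rule prod_cases3)
      obtain u v where "i \<in> I" "\<kappa> \<in> \<Lambda>" and u: "u \<in> codable i \<kappa>" "w = code i \<kappa> u" "\<rho> u = x"
        and v: "v \<in> codable i \<kappa>" "w' = code i \<kappa> v" "\<rho> v = x"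
        using word_value_eq_Some[OF r(2)] word_value_eq_Some[OF r(3)] r(4) Some t by metis
      moreover have "(u, v) \<in> vertex_relation X K \<rho> (G \<kappa>)"
        using u v by (simp add: vertex_relation_def free_semigroupoid_sel codable_def)
      ultimately show ?thesis
        unfolding r(1) coded_relation_def by blast
    qed
  next
    fix r assume "r \<in> ?R"
    then consider "r = (zero_word, zero_word)"
      | i \<kappa> u v where "i \<in> I" "\<kappa> \<in> \<Lambda>" "r = (code i \<kappa> u, code i \<kappa> v)" "u \<in> codable i \<kappa>" "v \<in> codable i \<kappa>" "\<rho> u = \<rho> v"
      by (auto simp: coded_relation_def vertex_relation_def)
    then show "r \<in> ?L"
      by cases (auto simp: code_words_def code_value)
  qed
  moreover have "recognizable (saturated_convolution ?R)"
    by (intro recognizable_saturated_convolution_Un recognizable_saturated_convolution_UN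
        recognizable_zero_zero recognizable_coded_vertex_relation finite_I finite_\<Lambda>)
  ultimately show ?thesis by simp
qed

lemma recognizable_times_zero: "recognizable (saturated_convolution (code_words \<times> {zero_word}))"
proof -
  have "code_words \<times> {zero_word} = {(zero_word, zero_word)} \<union>
      (\<Union>i\<in>I. \<Union>\<kappa>\<in>\<Lambda>. code i \<kappa> ` codable i \<kappa> \<times> {zero_word})"
    by (auto simp: code_words_def)
  moreover have "recognizable (saturated_convolution \<dots>)"
    by (intro recognizable_saturated_convolution_Un recognizable_saturated_convolution_UN
        recognizable_zero_zero recognizable_code_times_zero finite_I finite_\<Lambda>)
  ultimately show ?thesis by simp
qed

text \<open>The part of right multiplication by \<open>Some (n, s, \<mu>)\<close> that concerns
  first factors with outer indices \<open>i\<close> and \<open>\<kappa>\<close>; the entry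
  \<open>P \<kappa> n\<close> is then fixed.\<close>

definition product_relation ::
  "'i \<Rightarrow> 'a \<Rightarrow> 'l \<Rightarrow> 'i \<Rightarrow> 'l \<Rightarrow> ((('i \<times> 'a \<times> 'l) option \<times> 'e list) list \<times> (('i \<times> 'a \<times> 'l) option \<times> 'e list) list) set" where
  "product_relation n s \<mu> i \<kappa> = (case P \<kappa> n of None \<Rightarrow> code i \<kappa> ` codable i \<kappa> \<times> {zero_word}
     | Some p \<Rightarrow> coded_relation i \<kappa> \<mu> (right_relation (mult S p s)))"

lemma recognizable_product_relation:
  assumes "n \<in> I" "s \<in> arcs S" "\<mu> \<in> \<Lambda>" "F n = tail S s" "head S s = G \<mu>" "\<kappa> \<in> \<Lambda>"
  shows "recognizable (saturated_convolution (product_relation n s \<mu> i \<kappa>))"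
proof (cases "P \<kappa> n")
  case None
  then show ?thesis
    using recognizable_code_times_zero[OF assms(6)] by (simp add: product_relation_def)
next
  case (Some p)
  then have p: "p \<in> arcs S" "tail S p = G \<kappa>" "head S p = F n"
    using P_entry assms by blast+
  then have ps: "mult S p s \<in> arcs S" "tail S (mult S p s) = G \<kappa>" "head S (mult S p s) = G \<mu>"
    using assms by (simp_all add: mult_closed tail_mult head_mult)
  have "recognizable (saturated_convolution (coded_relation i \<kappa> \<mu> (right_relation (mult S p s))))"
  proof (rule recognizable_coded_relation)
    show "recognizable (saturated_convolution (right_relation (mult S p s)))"
      using recognizable_right_relation edge_recognizable ps(1) by blast
    fix u v assume "(u, v) \<in> right_relation (mult S p s)"
    then have *: "u \<in> arcs (free_semigroupoid X)" "v \<in> arcs (free_semigroupoid X)"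
      "head X (last u) = G \<kappa>" "mult S (\<rho> u) (mult S p s) = \<rho> v"
      using K_subset ps by (auto simp: right_relation_def)
    then have "head S (\<rho> v) = G \<mu>"
      using ps \<rho>_path[OF *(1)] head_mult[of "\<rho> u" "mult S p s"] by simp
    then show "head X (last u) = G \<kappa> \<and> head X (last v) = G \<mu>"
      using * \<rho>_path(3)[of v] by simp
  qed (auto simp: right_relation_def)
  then show ?thesis
    using Some by (simp add: product_relation_def)
qed

text \<open>Multiplying by zero sends every code word to \<open>zero_word\<close>. For a triple,
  splitting by the outer indices of the first factor leaves finitely many product relations.\<close>

lemma recognizable_right_multiplication:
  assumes "g \<in> rees_carrier S I \<Lambda> F G"
  shows "recognizable (saturated_convolution
    {(w, w') \<in> code_words \<times> code_words. rees_mult S P (word_value w) g = word_value w'})"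
    (is "recognizable (saturated_convolution ?L)")
proof (cases g)
  case None
  then have "?L = code_words \<times> {zero_word}"
    using word_value_eq_None zero_in_code_words by fastforce
  then show ?thesis by (simp add: recognizable_times_zero)
next
  case (Some t)
  obtain n s \<mu> where "t = (n, s, \<mu>)" by (rule prod_cases3)
  then have g: "g = Some (n, s, \<mu>)" and
    ns: "n \<in> I" "s \<in> arcs S" "\<mu> \<in> \<Lambda>" "F n = tail S s" "head S s = G \<mu>"
    using assms Some by (auto simp: rees_carrier_def)
  have "?L = {(zero_word, zero_word)} \<union> (\<Union>i\<in>I. \<Union>\<kappa>\<in>\<Lambda>. product_relation n s \<mu> i \<kappa>)" (is "_ = ?R")
  proof (intro equalityI subsetI)
    have entry: "p \<in> arcs S" "tail S p = G \<kappa>" "head S p = F n" if "\<kappa> \<in> \<Lambda>" "P \<kappa> n = Some p" for \<kappa> p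
      using P_entry that ns(1) by blast+
    \<comment> \<open>The Rees product brackets as \<open>(x p) s\<close>, whereas the relation on
      \<open>S\<close> multiplies by the fixed arrow \<open>p s\<close>.\<close>
    have assoc: "mult S (mult S (\<rho> u) p) s = mult S (\<rho> u) (mult S p s)"
      and right: "head X (last u) = tail S (mult S p s)"
      if "\<kappa> \<in> \<Lambda>" "P \<kappa> n = Some p" "u \<in> codable i \<kappa>" for i \<kappa> p u
    proof -
      have "\<rho> u \<in> arcs S" "head S (\<rho> u) = G \<kappa>" "head X (last u) = G \<kappa>"
        using codable_path[OF that(3)] that(3) \<rho>_path[of u] by (auto simp: codable_def)
      then show "mult S (mult S (\<rho> u) p) s = mult S (\<rho> u) (mult S p s)"
        and "head X (last u) = tail S (mult S p s)"
        using ns entry[OF that(1,2)] by (simp_all add: mult_assoc tail_mult)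
    qed
    {
      fix r assume "r \<in> ?L"
      then obtain w w' where r: "r = (w, w')" "w \<in> code_words" "w' \<in> code_words"
        "rees_mult S P (word_value w) g = word_value w'" by blast
      from r(2) show "r \<in> ?R"
      proof (cases rule: code_words_cases)
        case 1
        then show ?thesis using r word_value_eq_None[OF r(3)] by simp
      next
        case (2 i \<kappa> u)
        have "r \<in> product_relation n s \<mu> i \<kappa>"
        proof (cases "P \<kappa> n")
          case None
          then have "word_value w' = None"
            using r(4) 2 by (simp add: g code_value)
          then show ?thesis
            using r(1) 2 None word_value_eq_None[OF r(3)] by (simp add: product_relation_def)
        next
          case (Some p)
          then have "word_value w' = Some (i, mult S (mult S (\<rho> u) p) s, \<mu>)"
            using r(4) 2 by (simp add: g code_value)
          then obtain v where v: "v \<in> codable i \<mu>" "w' = code i \<mu> v" "\<rho> v = mult S (mult S (\<rho> u) p) s"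
            using word_value_eq_Some[OF r(3)] by blast
          then have "(u, v) \<in> right_relation (mult S p s)"
            using 2 Some assoc right codable_path by (simp add: right_relation_def)
          then show ?thesis
            using r(1) 2 v Some unfolding product_relation_def coded_relation_def by auto
        qed
        then show ?thesis using 2 by blast
      qed
    }
    fix r assume "r \<in> ?R"
    then consider "r = (zero_word, zero_word)"
      | i \<kappa> where "i \<in> I" "\<kappa> \<in> \<Lambda>" "r \<in> product_relation n s \<mu> i \<kappa>"
      by blast
    then show "r \<in> ?L"
    proof cases
      case 1
      then show ?thesis by (simp add: zero_in_code_words)
    next
      case (2 i \<kappa>)
      show ?thesis
      proof (cases "P \<kappa> n")
        case None
        then show ?thesis
          using 2 by (auto simp: product_relation_def g code_value code_in_code_words zero_in_code_words)
      next
        case (Some p)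
        then obtain u v where "r = (code i \<kappa> u, code i \<mu> v)" "u \<in> codable i \<kappa>" "v \<in> codable i \<mu>"
          "mult S (\<rho> u) (mult S p s) = \<rho> v"
          using 2(3) by (auto simp: product_relation_def coded_relation_def right_relation_def)
        then show ?thesis
          using 2(1,2) Some ns(3) assoc[OF 2(2) Some] by (simp add: g code_value code_in_code_words)
      qed
    qed
  qed
  moreover have "recognizable (saturated_convolution ?R)"
    by (intro recognizable_saturated_convolution_Un recognizable_saturated_convolution_UN
        recognizable_zero_zero recognizable_product_relation finite_I finite_\<Lambda> ns)
  ultimately show ?thesis by simp
qed

theorem automatic_rees_semigroup: "automatic (rees_semigroup S I \<Lambda> F G P)"
  unfolding rees_semigroup_def
proof (rule automatic_semigroupI)
  show "semigroupoid (semigroup_as_semigroupoid (rees_carrier S I \<Lambda> F G) (rees_mult S P))"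
    using semigroup by (simp add: rees_semigroup_def)
  show "finite alphabet" by (rule finite_alphabet)
  show "fst ` alphabet \<subseteq> rees_carrier S I \<Lambda> F G" by (auto simp: alphabet_def)
  show "code_words \<subseteq> lists alphabet - {[]}" by (rule code_words_subset)
  show "word_value ` code_words = rees_carrier S I \<Lambda> F G" by (rule word_value_code_words)
  show "recognizable (saturated_convolution
      {(w, w') \<in> code_words \<times> code_words. word_value w = word_value w'})"
    by (rule recognizable_equal_values)
  show "recognizable (saturated_convolution
      {(w, w') \<in> code_words \<times> code_words. rees_mult S P (word_value w) (fst y) = word_value w'})"
    if "y \<in> alphabet" for y
    using that by (intro recognizable_right_multiplication) (simp add: alphabet_def)
qed

end

subsection \<open>Pumping\<close>

lemma not_blocks_inE:
  assumes "\<not> blocks_in k Q u"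
  obtains x B y where "u = x @ B @ y" "length B = Suc k" "\<not> Q B"
  using assms
proof (induction k Q u arbitrary: thesis rule: blocks_in.induct)
  case (1 k Q u)
  have long: "\<not> length u \<le> k"
    using "1.prems"(2) by (auto simp: blocks_in.simps[of k Q u])
  show ?case
  proof (cases "Q (take (Suc k) u)")
    case True
    then have "\<not> blocks_in k Q (drop (Suc k) u)"
      using "1.prems"(2) long by (auto simp: blocks_in.simps[of k Q u])
    then obtain x B y where "drop (Suc k) u = x @ B @ y" "length B = Suc k" "\<not> Q B"
      using "1.IH"[OF long] by blast
    then show ?thesis
      using "1.prems"(1)[of "take (Suc k) u @ x" B y] append_take_drop_id[of "Suc k" u] by simp
  next
    case False
    then show ?thesis
      using "1.prems"(1)[of "[]" "take (Suc k) u" "drop (Suc k) u"] long by simp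
  qed
qed

context choice_of_representatives
begin

text \<open>Pumping: inside a long factor of a word of \<open>K\<close> all of whose prefixes have values in the finite set
  \<open>arcs S - V\<close>, two prefixes agree in value and in the state of an automaton for \<open>K\<close>, so the part
  between them can be cut out. Hence shortest representatives have no such factor.\<close>

lemma blocks_in_shortest:
  assumes fin: "finite (range (residual K))" "finite (arcs S - V)"
    and V: "\<And>x y. \<lbrakk>x \<in> V; x \<in> arcs S; y \<in> arcs S; head S x = tail S y\<rbrakk> \<Longrightarrow> mult S x y \<in> V"
    and k: "card (range (residual K)) * card (arcs S - V) \<le> k"
    and u: "u \<in> K" and shortest: "\<And>v. \<lbrakk>v \<in> K; \<rho> v = \<rho> u\<rbrakk> \<Longrightarrow> length u \<le> length v"
  shows "blocks_in k (\<lambda>B. \<rho> B \<in> V) u"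
proof (rule ccontr)
  assume "\<not> blocks_in k (\<lambda>B. \<rho> B \<in> V) u"
  then obtain x B y where B: "u = x @ B @ y" "length B = Suc k" "\<rho> B \<notin> V"
    by (rule not_blocks_inE)
  have path: "x @ B @ y \<in> arcs (free_semigroupoid X)"
    using u K_subset B(1) by auto
  have B_path: "B \<in> arcs (free_semigroupoid X)"
    using path B(2) by (auto simp: paths_iff[OF wf_X] successively_append_iff)
  have prefix: "take n B \<in> arcs (free_semigroupoid X)" "\<rho> (take n B) \<in> arcs S - V" if "n \<in> {1..Suc k}" for n
  proof -
    have ne: "take n B \<noteq> []"
      using that B(2) by auto
    show 1: "take n B \<in> arcs (free_semigroupoid X)"
      using B_path ne paths_append_iff[OF wf_X, of "take n B" "drop n B"] by (cases "drop n B = []") auto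
    \<comment> \<open>\<open>V\<close> absorbs factors on the right, so a prefix with value in
      \<open>V\<close> would put the value of \<open>B\<close> into \<open>V\<close>.\<close>
    have "\<rho> (take n B) \<notin> V"
    proof (cases "drop n B = []")
      case True
      then show ?thesis using B(3) by simp
    next
      case False
      then have "\<rho> B = mult S (\<rho> (take n B)) (\<rho> (drop n B))"
        using \<rho>_append[of "take n B" "drop n B"] B_path ne by simp
      moreover have "drop n B \<in> arcs (free_semigroupoid X)"
        "head X (last (take n B)) = tail X (hd (drop n B))"
        using B_path ne False paths_append_iff[OF wf_X, of "take n B" "drop n B"] by auto
      ultimately show ?thesis
        using V[of "\<rho> (take n B)" "\<rho> (drop n B)"] B(3) \<rho>_path 1 by auto
    qed
    then show "\<rho> (take n B) \<in> arcs S - V"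
      using \<rho>_path(1)[OF 1] by simp
  qed
  \<comment> \<open>Automaton state and value after each prefix. There are \<open>Suc k\<close>
    non-empty prefixes but at most \<open>k\<close> such pairs, so two prefixes collide.\<close>
  define f where "f n = (residual K (x @ take n B), \<rho> (take n B))" for n
  have "f ` {1..Suc k} \<subseteq> range (residual K) \<times> (arcs S - V)"
    using prefix(2) by (auto simp: f_def)
  then have "card (f ` {1..Suc k}) \<le> card (range (residual K) \<times> (arcs S - V))"
    using fin by (intro card_mono) auto
  also have "\<dots> < card {1..Suc k}"
    using k by (simp add: card_cartesian_product)
  finally have "\<not> inj_on f {1..Suc k}"
    by (rule pigeonhole)
  then obtain m n where mn: "m \<in> {1..Suc k}" "n \<in> {1..Suc k}" "m < n" "f m = f n"
    unfolding inj_on_def by (metis linorder_neqE_nat)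
  define z where "z = drop n B @ y"
  have uz: "u = x @ take n B @ z"
    unfolding B(1) z_def by simp
  \<comment> \<open>The longer prefix is replaced by the shorter one: equal residuals keep the word
    in \<open>K\<close>, and equal values keep the value of the whole word.\<close>
  define v where "v = x @ take m B @ z"
  have "z \<in> residual K (x @ take n B)"
    using u uz by (simp add: residual_def)
  then have "z \<in> residual K (x @ take m B)"
    using mn(4) by (simp add: f_def)
  then have v: "v \<in> K"
    by (simp add: residual_def v_def)
  have "\<rho> v = \<rho> u"
  proof -
    have same: "\<rho> (take m B) = \<rho> (take n B)"
      using mn(4) by (simp add: f_def)
    have ne: "take m B \<noteq> []" "take n B \<noteq> []"
      using mn B(2) by auto
    have sub: "\<And>p q. p @ q \<in> arcs (free_semigroupoid X) \<Longrightarrow> q \<noteq> [] \<Longrightarrow> q \<in> arcs (free_semigroupoid X)"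
      by (auto simp: paths_iff[OF wf_X] successively_append_iff)
    have paths: "v \<in> arcs (free_semigroupoid X)" "u \<in> arcs (free_semigroupoid X)"
      using u v K_subset by auto
    have tails: "take m B @ z \<in> arcs (free_semigroupoid X)" "take n B @ z \<in> arcs (free_semigroupoid X)"
      using sub[of x "take m B @ z"] sub[of x "take n B @ z"] paths ne by (auto simp: v_def uz)
    have "\<rho> (take m B @ z) = \<rho> (take n B @ z)"
      using tails ne same by (cases "z = []") (simp_all add: \<rho>_append)
    then show ?thesis
      using paths ne unfolding v_def uz by (cases "x = []") (simp_all add: \<rho>_append)
  qed
  moreover have "length v < length u"
    using mn B(2) unfolding v_def uz by simp
  ultimately show False
    using shortest[OF v] by simp
qed

text \<open>A word lies in \<open>K\<close> exactly when it is related to itself by the vertex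
  relation at its target. The convolution of such a pair doubles each letter and has no padding, so
  \<open>K\<close> is a finite union of inverse images.\<close>

lemma recognizable_representatives:
  assumes "finite (verts X)"
    and vertex: "\<And>s. s \<in> verts X \<Longrightarrow> recognizable (saturated_convolution (vertex_relation X K \<rho> s))"
  shows "recognizable K"
proof -
  let ?d = "\<lambda>x. (Some x, Some x)"
  have diagonal: "padded_zip (length u) (u, u) = map ?d u" for u :: "'e list"
    by (simp add: padded_zip_def padded_def zip_map_map zip_same_conv_map)
  have "K = (\<Union>s\<in>verts X. {u. map ?d u \<in> convolution (vertex_relation X K \<rho> s)})"
  proof (intro equalityI subsetI)
    fix u assume u: "u \<in> K"
    then have "u \<in> arcs (free_semigroupoid X)"
      using K_subset by auto
    then have "last u \<in> arcs X"
      by (auto simp: paths_iff[OF wf_X])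
    then have "head X (last u) \<in> verts X"
      by simp
    moreover have "map ?d u \<in> convolution (vertex_relation X K \<rho> (head X (last u)))"
      using u unfolding convolution_def diagonal[symmetric]
      by (intro image_eqI[of _ _ "(u, u)"]) (auto simp: vertex_relation_def free_semigroupoid_sel)
    ultimately show "u \<in> (\<Union>s\<in>verts X. {u. map ?d u \<in> convolution (vertex_relation X K \<rho> s)})"
      by blast
  next
    fix u assume "u \<in> (\<Union>s\<in>verts X. {u. map ?d u \<in> convolution (vertex_relation X K \<rho> s)})"
    then obtain s v w where vw: "(v, w) \<in> vertex_relation X K \<rho> s"
      "map ?d u = padded_zip (max (length v) (length w)) (v, w)"
      by (auto simp: convolution_def)
    have "padded (length u) u = map fst (map ?d u)"
      by (simp add: padded_def comp_def)
    also have "\<dots> = padded (max (length v) (length w)) v"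
      unfolding vw(2) by (simp add: map_padded_zip)
    finally have "u = v"
      by (rule padded_inj)
    then show "u \<in> K"
      using vw(1) by (simp add: vertex_relation_def)
  qed
  moreover have "recognizable (\<Union>s\<in>verts X. {u. map ?d u \<in> convolution (vertex_relation X K \<rho> s)})"
    using assms by (intro recognizable_UN recognizable_map_vimage)
      (simp_all add: recognizable_saturated_convolution_iff)
  ultimately show ?thesis by simp
qed

end

section \<open>Consequences of finite generation\<close>

context rees_data
begin

text \<open>The set \<open>V\<close> of the overview: the middle entries of nonzero products of two
  elements of the Rees matrix semigroup.\<close>

definition sandwiched :: "'a set" where
  "sandwiched = {mult S (mult S x p) y | x p y n i. x \<in> arcs S \<and> y \<in> arcs S \<and> n \<in> \<Lambda> \<and> i \<in> I \<and>
     head S x = G n \<and> tail S y = F i \<and> P n i = Some p}"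

text \<open>The factor \<open>z\<close> is absorbed into \<open>y\<close>. This is the closure
  property required for pumping.\<close>

lemma sandwiched_right_ideal:
  assumes "x \<in> sandwiched" "z \<in> arcs S" "head S x = tail S z"
  shows "mult S x z \<in> sandwiched"
proof -
  obtain w p y n i where x: "x = mult S (mult S w p) y" "w \<in> arcs S" "y \<in> arcs S" "n \<in> \<Lambda>" "i \<in> I"
    "head S w = G n" "tail S y = F i" "P n i = Some p"
    using assms(1) unfolding sandwiched_def by blast
  then have p: "p \<in> arcs S" "tail S p = G n" "head S p = F i"
    using P_entry by blast+
  then have wp: "mult S w p \<in> arcs S" "head S (mult S w p) = F i"
    using x by (simp_all add: mult_closed head_mult)
  then have "head S y = tail S z"
    using assms(3) x by (simp add: head_mult)
  then have "mult S x z = mult S (mult S w p) (mult S y z)" "mult S y z \<in> arcs S" "tail S (mult S y z) = F i"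
    using wp x assms(2) by (simp_all add: mult_assoc mult_closed tail_mult)
  then show ?thesis
    using x unfolding sandwiched_def by blast
qed

lemma rees_element_exists:
  assumes "x \<in> arcs S"
  shows "\<exists>i\<in>I. \<exists>n\<in>\<Lambda>. Some (i, x, n) \<in> rees_carrier S I \<Lambda> F G"
proof -
  have "tail S x \<in> F ` I" "head S x \<in> G ` \<Lambda>"
    using assms F_surj G_surj by auto
  then show ?thesis
    using assms by (auto simp: rees_carrier_def)
qed

text \<open>Every element is a generator or a product that begins, and likewise ends, with one. A
  nonzero product inherits its first index from the left factor and its last index from the right
  one, so all indices occur in generators; an element whose middle entry is not sandwiched is no
  product at all.\<close>

lemma finitely_generated_rees_semigroup:
  assumes "finitely_generated (rees_semigroup S I \<Lambda> F G P)"
  shows "semigroupoid (rees_semigroup S I \<Lambda> F G P)"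
    and "finite I" "finite \<Lambda>" "finite (arcs S - sandwiched)"
proof -
  obtain Y :: "(unit, nat) pre_digraph" and L \<tau> where
    Y: "choice_of_representatives (rees_semigroup S I \<Lambda> F G P) Y L \<tau>" "finite (arcs Y)"
    using assms unfolding finitely_generated_def by blast
  interpret Y: choice_of_representatives "rees_semigroup S I \<Lambda> F G P" Y L \<tau> by (rule Y(1))
  show "semigroupoid (rees_semigroup S I \<Lambda> F G P)"
    by (rule choice_of_representatives.axioms(1)[OF Y(1)])
  define C where "C = rees_carrier S I \<Lambda> F G"
  have M: "arcs (rees_semigroup S I \<Lambda> F G P) = C" "mult (rees_semigroup S I \<Lambda> F G P) = rees_mult S P"
    by (simp_all add: rees_semigroup_def semigroup_as_semigroupoid_def C_def)
  define gens where "gens = (\<lambda>e. \<tau> [e]) ` arcs Y"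
  have fin: "finite gens"
    using Y(2) by (simp add: gens_def)
  \<comment> \<open>A word is split after its first or before its last edge. The first version
    records membership in \<open>C\<close>, which the argument on sandwiched arrows uses.\<close>
  have split: "m \<in> gens \<or> (\<exists>g\<in>gens \<inter> C. \<exists>m'\<in>C. m = rees_mult S P g m')"
    and split': "m \<in> gens \<or> (\<exists>g\<in>gens. \<exists>m'. m = rees_mult S P m' g)" if "m \<in> C" for m
  proof -
    have "m \<in> \<tau> ` arcs (free_semigroupoid Y)"
      using that Y.surj M by simp
    then obtain w where w: "w \<in> arcs (free_semigroupoid Y)" "m = \<tau> w"
      by blast
    then have ne: "w \<noteq> []" and edges: "set w \<subseteq> arcs Y"
      by (simp_all add: paths_iff[OF Y.wf_X])
    have "(m \<in> gens \<or> (\<exists>g\<in>gens \<inter> C. \<exists>m'\<in>C. m = rees_mult S P g m')) \<and>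
      (m \<in> gens \<or> (\<exists>g\<in>gens. \<exists>m'. m = rees_mult S P m' g))"
    proof (cases "tl w = []")
      case True
      with ne obtain e where "w = [e]" by (cases w) auto
      then show ?thesis
        using edges w(2) by (auto simp: gens_def)
    next
      case False
      then have bl: "butlast w \<noteq> []"
        using ne by (cases w) auto
      have "\<tau> w = rees_mult S P (\<tau> [hd w]) (\<tau> (tl w))"
        using Y.\<rho>_append[of "[hd w]" "tl w"] w(1) False ne M by simp
      moreover have "\<tau> w = rees_mult S P (\<tau> (butlast w)) (\<tau> [last w])"
        using Y.\<rho>_append[of "butlast w" "[last w]"] w(1) bl ne M by simp
      moreover have "hd w \<in> arcs Y" "last w \<in> arcs Y"
        using ne edges by auto
      then have "\<tau> [hd w] \<in> gens" "\<tau> [last w] \<in> gens"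
        by (simp_all add: gens_def)
      moreover have "[hd w] \<in> arcs (free_semigroupoid Y)" "tl w \<in> arcs (free_semigroupoid Y)"
        using w(1) ne False paths_append_iff[OF Y.wf_X, of "[hd w]" "tl w"] by simp_all
      then have "\<tau> [hd w] \<in> C" "\<tau> (tl w) \<in> C"
        using Y.\<rho>_path(1) M by auto
      ultimately show ?thesis
        using w(2) by blast
    qed
    then show "m \<in> gens \<or> (\<exists>g\<in>gens \<inter> C. \<exists>m'\<in>C. m = rees_mult S P g m')"
      and "m \<in> gens \<or> (\<exists>g\<in>gens. \<exists>m'. m = rees_mult S P m' g)"
      by blast+
  qed
  show "finite I"
  proof (rule finite_subset)
    show "finite ((\<lambda>g. fst (the g)) ` gens)" using fin by simp
    show "I \<subseteq> (\<lambda>g. fst (the g)) ` gens"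
    proof
      fix i assume "i \<in> I"
      then have "F i \<in> tail S ` arcs S"
        using F_surj by blast
      then obtain x where x: "x \<in> arcs S" "F i = tail S x"
        by blast
      moreover have "head S x \<in> G ` \<Lambda>"
        using G_surj x by blast
      then obtain n where "n \<in> \<Lambda>" "head S x = G n"
        by blast
      ultimately have "Some (i, x, n) \<in> C"
        using \<open>i \<in> I\<close> by (simp add: C_def rees_carrier_def)
      \<comment> \<open>The product is nonzero, so the generator on its left is a triple and shares
        the index \<open>i\<close>.\<close>
      from split[OF this] have "\<exists>g\<in>gens. \<exists>y m. g = Some (i, y, m)"
        by (metis (no_types) rees_mult_eq_Some IntD1)
      then show "i \<in> (\<lambda>g. fst (the g)) ` gens" by force
    qed
  qed
  show "finite \<Lambda>"
  proof (rule finite_subset)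
    show "finite ((\<lambda>g. snd (snd (the g))) ` gens)" using fin by simp
    show "\<Lambda> \<subseteq> (\<lambda>g. snd (snd (the g))) ` gens"
    proof
      fix n assume "n \<in> \<Lambda>"
      then have "G n \<in> head S ` arcs S"
        using G_surj by blast
      then obtain x where x: "x \<in> arcs S" "G n = head S x"
        by blast
      moreover have "tail S x \<in> F ` I"
        using F_surj x by blast
      then obtain i where "i \<in> I" "F i = tail S x"
        by force
      ultimately have "Some (i, x, n) \<in> C"
        using \<open>n \<in> \<Lambda>\<close> by (simp add: C_def rees_carrier_def)
      from split'[OF this] have "\<exists>g\<in>gens. \<exists>y j. g = Some (j, y, n)"
        by (metis (no_types) rees_mult_eq_Some)
      then show "n \<in> (\<lambda>g. snd (snd (the g))) ` gens" by force
    qed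
  qed
  show "finite (arcs S - sandwiched)"
  proof (rule finite_subset)
    show "finite ((\<lambda>g. fst (snd (the g))) ` gens)" using fin by simp
    show "arcs S - sandwiched \<subseteq> (\<lambda>g. fst (snd (the g))) ` gens"
    proof
      fix x assume x: "x \<in> arcs S - sandwiched"
      then obtain i n where m: "Some (i, x, n) \<in> C"
        using rees_element_exists unfolding C_def by blast
      have "Some (i, x, n) \<in> gens"
      proof (rule ccontr)
        assume "Some (i, x, n) \<notin> gens"
        then obtain g h where gh: "g \<in> C" "h \<in> C" "rees_mult S P g h = Some (i, x, n)"
          using split[OF m] by auto
        then obtain y m' j z p where "g = Some (i, y, m')" "h = Some (j, z, n)" "P m' j = Some p"
          "x = mult S (mult S y p) z"
          unfolding rees_mult_eq_Some by blast
        moreover from this gh(1,2) have "y \<in> arcs S \<and> z \<in> arcs S \<and> m' \<in> \<Lambda> \<and> j \<in> I \<and>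
            head S y = G m' \<and> tail S z = F j"
          by (auto simp: C_def rees_carrier_def)
        ultimately have "x \<in> sandwiched"
          unfolding sandwiched_def by blast
        with x show False by blast
      qed
      then show "x \<in> (\<lambda>g. fst (snd (the g))) ` gens" by force
    qed
  qed
qed

end

section \<open>Assembling the encoding from an automatic structure of \<open>S\<close>\<close>

theorem theorem4p4:
  fixes S :: "('o, 'a) semigroupoid"
    and I :: "'i set" and \<Lambda> :: "'l set"
    and F :: "'i \<Rightarrow> 'o" and G :: "'l \<Rightarrow> 'o"
    and P :: "'l \<Rightarrow> 'i \<Rightarrow> 'a option"
  assumes "rees_data S I \<Lambda> F G P"
    and "automatic S"
    and "finitely_generated (rees_semigroup S I \<Lambda> F G P)"
  shows "automatic (rees_semigroup S I \<Lambda> F G P)"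
proof -
  interpret rees_data S I \<Lambda> F G P by fact
  note fg = finitely_generated_rees_semigroup[OF assms(3)]
  obtain X :: "('o, nat) pre_digraph" and K \<rho> where X: "choice_of_representatives S X K \<rho>" "fin_digraph X"
    and sync: "\<forall>a\<in>arcs X. synchronously_regular X (edge_relation X K \<rho> a)"
      "\<forall>s\<in>verts X. synchronously_regular X (vertex_relation X K \<rho> s)"
    using assms(2) unfolding automatic_def automatic_structure_def by blast
  interpret X: choice_of_representatives S X K \<rho> by fact
  have finX: "finite (arcs X)" "finite (verts X)"
    using X(2) by (simp_all add: fin_digraph.finite_arcs fin_digraph.finite_verts)
  have edge: "recognizable (saturated_convolution (edge_relation X K \<rho> a))" if "a \<in> arcs X" for a
    using that sync(1) recognizable_if_synchronously_regular by blast
  have vertex: "recognizable (saturated_convolution (vertex_relation X K \<rho> s))" if "s \<in> verts X" for s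
    using that sync(2) recognizable_if_synchronously_regular by blast
  have K: "finite (range (residual K))"
    using X.recognizable_representatives[OF finX(2) vertex] by (simp add: recognizable_def)
  \<comment> \<open>The number of pairs of a residual of \<open>K\<close> and an arrow outside
    \<open>sandwiched\<close>, as the pigeonhole argument demands.\<close>
  define k where "k = card (range (residual K)) * card (arcs S - sandwiched)"
  have cover: "\<exists>u\<in>K. blocks_in k (\<lambda>B. \<rho> B \<in> sandwiched) u \<and> \<rho> u = x" if "x \<in> arcs S" for x
  proof -
    have "x \<in> \<rho> ` K"
      using that X.image_K by simp
    then obtain u0 where "u0 \<in> K \<and> \<rho> u0 = x"
      by blast
    \<comment> \<open>A shortest representative cannot be pumped down, which makes its blocks
      sandwiched.\<close>
    from ex_has_least_nat[of "\<lambda>u. u \<in> K \<and> \<rho> u = x", OF this, of length]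
    obtain u where u: "u \<in> K" "\<rho> u = x" "\<And>v. v \<in> K \<Longrightarrow> \<rho> v = x \<Longrightarrow> length u \<le> length v"
      by blast
    have "blocks_in k (\<lambda>B. \<rho> B \<in> sandwiched) u"
    proof (rule X.blocks_in_shortest[OF K fg(4)])
      show "card (range (residual K)) * card (arcs S - sandwiched) \<le> k"
        by (simp add: k_def)
      show "u \<in> K" by (rule u(1))
      show "length u \<le> length v" if "v \<in> K" "\<rho> v = \<rho> u" for v
        using that u(2,3) by simp
    qed (rule sandwiched_right_ideal)
    then show ?thesis using u by blast
  qed
  \<comment> \<open>One factorization of each sandwiched arrow is chosen once and for all, so that
    the encoding is a function of the word.\<close>
  have "\<forall>x\<in>sandwiched. \<exists>b n i c. b \<in> arcs S \<and> c \<in> arcs S \<and> n \<in> \<Lambda> \<and> i \<in> I \<and>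
      head S b = G n \<and> tail S c = F i \<and> (\<exists>p. P n i = Some p \<and> x = mult S (mult S b p) c)"
    unfolding sandwiched_def by blast
  then obtain b n i c where factors: "\<forall>x\<in>sandwiched. b x \<in> arcs S \<and> c x \<in> arcs S \<and> n x \<in> \<Lambda> \<and> i x \<in> I \<and>
      head S (b x) = G (n x) \<and> tail S (c x) = F (i x) \<and>
      (\<exists>p. P (n x) (i x) = Some p \<and> x = mult S (mult S (b x) p) (c x))"
    by metis
  interpret rees_encoding S I \<Lambda> F G P X K \<rho> k sandwiched b n i c
    by (intro rees_encoding.intro rees_encoding_axioms.intro assms(1) X(1) fg finX edge vertex cover
        factors[rule_format])
  show ?thesis
    by (rule automatic_rees_semigroup)
qed

end
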